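(* Let $X$ be a Banach space with property $( * )$. Let $Y\subset X$ be a closed linear subspace and $f:Y\to\mathbb{R}$ a $\mathcal{C}^1$-smooth function. Then there is a $\mathcal{C}^1$-smooth function $H:X\to\mathbb{R}$ with $H|_Y=f$. Furthermore, there is a constant $C\ge 1$ depending only on $X$ such that whenever $f:Y\to\mathbb{R}$ is $\mathcal{C}^1$-smooth and Lipschitz on $Y$, there is a $\mathcal{C}^1$-smooth and Lipschitz function $H:X\to\mathbb{R}$ with $H|_Y=f$ and $\operatorname{Lip}(H)\le C\operatorname{Lip}(f)$.
   Context: A Banach space $X$ has property $( * )$ if there is a constant $C_0$, depending only on $X$, such that for every Lipschitz function $f:X\to\mathbb{R}$ and every $\varepsilon>0$ there is a Lipschitz, $\mathcal{C}^1$-smooth function $K:X\to\mathbb{R}$ with $|f(x)-K(x)|<\varepsilon$ for all $x\in X$ and $\operatorname{Lip}(K)\le C_0\operatorname{Lip}(f)$. $\operatorname{Lip}(h)$ denotes the Lipschitz constant of $h$. *)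

theory Defs
  imports "HOL-Analysis.Analysis"
begin

definition C1_smooth :: "('a::real_normed_vector \<Rightarrow> real) \<Rightarrow> bool" where
  "C1_smooth f \<longleftrightarrow> (\<exists>f' :: 'a \<Rightarrow> ('a \<Rightarrow>\<^sub>L real).
      (\<forall>x. (f has_derivative blinfun_apply (f' x)) (at x)) \<and> continuous_on UNIV f')"

text \<open>C^1-smoothness of a function defined on a linear subspace Y (regarded as a normed
  space in its own right): Frechet differentiable along Y at every point of Y, with
  derivative (an element of the dual of Y, represented by a bounded linear functional
  whose restriction to Y is what matters) depending continuously on the point,
  w.r.t. the operator norm of Y*.\<close>
definition C1_smooth_on :: "'a::real_normed_vector set \<Rightarrow> ('a \<Rightarrow> real) \<Rightarrow> bool" where
  "C1_smooth_on Y f \<longleftrightarrow> (\<exists>f' :: 'a \<Rightarrow> ('a \<Rightarrow>\<^sub>L real).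
      (\<forall>x\<in>Y. (f has_derivative blinfun_apply (f' x)) (at x within Y)) \<and>
      (\<forall>x\<in>Y. \<forall>e>0. \<exists>d>0. \<forall>y\<in>Y. dist y x < d \<longrightarrow>
          (\<forall>v\<in>Y. \<bar>f' y v - f' x v\<bar> \<le> e * norm v)))"

definition Lip :: "'a::metric_space set \<Rightarrow> ('a \<Rightarrow> 'b::metric_space) \<Rightarrow> real" where
  "Lip U f = Inf {L. lipschitz_on L U f}"

definition lipschitz_fun :: "'a::metric_space set \<Rightarrow> ('a \<Rightarrow> 'b::metric_space) \<Rightarrow> bool" where
  "lipschitz_fun U f \<longleftrightarrow> (\<exists>L. lipschitz_on L U f)"

definition property_star :: "'a::banach itself \<Rightarrow> bool" where
  "property_star _ \<longleftrightarrow> (\<exists>C0::real. \<forall>f :: 'a \<Rightarrow> real. lipschitz_fun UNIV f \<longrightarrow>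
      (\<forall>\<epsilon>>0. \<exists>K :: 'a \<Rightarrow> real. C1_smooth K \<and> lipschitz_fun UNIV K \<and>
          (\<forall>x. \<bar>f x - K x\<bar> < \<epsilon>) \<and> Lip UNIV K \<le> C0 * Lip UNIV f))"

end

theory Submission
  imports Defs
begin

text \<open>Near a point \<open>s \<in> Y\<close> the function \<open>f\<close> minus its tangent functional has small Lipschitz
  constant on \<open>Y\<close>; extending this difference to \<open>X\<close> and smoothing it by property (*) gives a local
  \<open>C\<^sup>1\<close> function on \<open>X\<close> that is close to \<open>f\<close> on \<open>Y\<close> together with its derivative along \<open>Y\<close>.  Such
  local functions are glued by a \<open>C\<^sup>1\<close> partition of unity, whose existence also follows from (*); the
  closeness demanded at level \<open>n\<close> is chosen after the derivative bound of the \<open>n\<close>-th partition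
  function, so that the terms \<open>\<phi>\<^sub>n' (h\<^sub>n - f)\<close> are negligible.  The remaining error on \<open>Y\<close> is again \<open>C\<^sup>1\<close>,
  with as small a Lipschitz constant as desired, and is approximated in turn; the sum of the
  approximations converges in \<open>C\<^sup>1\<close> to an extension of \<open>f\<close>.\<close>

section \<open>Continuously differentiable functions with a given derivative\<close>

text \<open>\<open>X\<close> need not be separable, so an ordinary partition of unity could have
  uncountably many members and admit no summable choice of tolerances. The partition used here is
  indexed by \<open>nat\<close>: the centre \<open>b n x\<close> attached to its n-th member varies
  with \<open>x\<close>, but is locally constant wherever \<open>\<phi> n\<close> is active, so the
  glued terms remain C^1. For the Lipschitz statement closeness on \<open>Y\<close> is not enough,
  since \<open>\<phi>' n (h n - F)\<close> has to be small on all of \<open>X\<close>, with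
  \<open>F\<close> one global Lipschitz extension of \<open>f\<close>. Hence the tangent functional
  is extended from \<open>Y\<close> with norm at most \<open>L\<close>, and the local functions are
  truncated around a smoothing of \<open>F\<close>. Constants: the smoothing has derivative at most
  \<open>C L\<close>, the local tangent approximation differs from it by at most
  \<open>(C + 2) L\<close> in derivative, and gluing costs another \<open>L\<close>, in total
  \<open>(2 C + 3) L\<close>. The halving iteration for the remainder adds twice that, whence
  \<open>3 (2 C + 3)\<close>, which depends on \<open>X\<close> only through
  \<open>C\<close>.\<close>

definition C1_deriv :: "('a::real_normed_vector \<Rightarrow> real) \<Rightarrow> ('a \<Rightarrow> ('a \<Rightarrow>\<^sub>L real)) \<Rightarrow> bool" where
  "C1_deriv f f' \<longleftrightarrow> (\<forall>x. (f has_derivative blinfun_apply (f' x)) (at x) \<and> isCont f' x)"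

lemma C1_smooth_iff: "C1_smooth f \<longleftrightarrow> (\<exists>f'. C1_deriv f f')"
  by (simp add: C1_smooth_def C1_deriv_def continuous_on_eq_continuous_at all_conj_distrib)

lemma C1_deriv_isCont: "C1_deriv f f' \<Longrightarrow> isCont f x"
  unfolding C1_deriv_def by (meson has_derivative_continuous)

lemma C1_deriv_const: "C1_deriv (\<lambda>x. c) (\<lambda>x. 0)"
  by (auto simp: C1_deriv_def zero_blinfun.rep_eq)

lemma C1_deriv_blinfun: "C1_deriv (blinfun_apply T) (\<lambda>x. T)"
  by (auto simp: C1_deriv_def intro!: bounded_linear_imp_has_derivative blinfun.bounded_linear_right)

lemma C1_deriv_add:
  assumes "C1_deriv f f'" "C1_deriv g g'"
  shows "C1_deriv (\<lambda>x. f x + g x) (\<lambda>x. f' x + g' x)"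
  using assms unfolding C1_deriv_def
  by (auto simp: blinfun.add_left intro!: derivative_eq_intros continuous_intros)

lemma C1_deriv_diff:
  assumes "C1_deriv f f'" "C1_deriv g g'"
  shows "C1_deriv (\<lambda>x. f x - g x) (\<lambda>x. f' x - g' x)"
  using assms unfolding C1_deriv_def
  by (auto simp: blinfun.diff_left intro!: derivative_eq_intros continuous_intros)

lemma C1_deriv_mult:
  assumes "C1_deriv f f'" "C1_deriv g g'"
  shows "C1_deriv (\<lambda>x. f x * g x) (\<lambda>x. f x *\<^sub>R g' x + g x *\<^sub>R f' x)"
proof -
  have "isCont f x" "isCont g x" for x
    using assms C1_deriv_isCont by auto
  with assms show ?thesis unfolding C1_deriv_def
    by (auto simp: blinfun.add_left blinfun.scaleR_left intro!: derivative_eq_intros continuous_intros)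
qed

lemma C1_deriv_compose:
  assumes "C1_deriv f f'"
    and "\<And>t. (u has_real_derivative u' t) (at t)" and "\<And>t. isCont u' t"
  shows "C1_deriv (\<lambda>x. u (f x)) (\<lambda>x. u' (f x) *\<^sub>R f' x)"
proof -
  have "((\<lambda>x. u (f x)) has_derivative blinfun_apply (u' (f x) *\<^sub>R f' x)) (at x)" for x
  proof -
    have "(u has_derivative (*) (u' (f x))) (at (f x))"
      using assms(2) by (simp add: has_field_derivative_def)
    moreover have "(f has_derivative blinfun_apply (f' x)) (at x)"
      using assms(1) by (simp add: C1_deriv_def)
    ultimately show ?thesis
      using has_derivative_compose[of f _ x UNIV u "(*) (u' (f x))"]
      by (simp add: scaleR_blinfun.rep_eq)
  qed
  moreover have "isCont (\<lambda>x. u' (f x)) x" for x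
    by (rule isCont_o2[OF C1_deriv_isCont[OF assms(1)] assms(3)])
  ultimately show ?thesis
    using assms(1) unfolding C1_deriv_def by (auto intro!: continuous_intros)
qed

lemma C1_deriv_sum:
  fixes N :: nat
  assumes "\<And>n. n < N \<Longrightarrow> C1_deriv (f n) (f' n)"
  shows "C1_deriv (\<lambda>x. \<Sum>n<N. f n x) (\<lambda>x. \<Sum>n<N. f' n x)"
  using assms
proof (induction N)
  case 0
  then show ?case using C1_deriv_const[of 0] by simp
next
  case (Suc N)
  then show ?case by (auto intro!: C1_deriv_add)
qed

text \<open>Meant for locally finite sums and for products with a locally constant index: near each
  point such a function coincides with one fixed C^1 function.\<close>

lemma C1_deriv_local:
  assumes "\<And>x. \<exists>d>0. \<exists>g g'. C1_deriv g g' \<and> (\<forall>y\<in>ball x d. f y = g y \<and> f' y = g' y)"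
  shows "C1_deriv f f'"
  unfolding C1_deriv_def
proof (intro allI)
  fix x
  obtain d g g' where d: "d > 0" and g: "C1_deriv g g'"
    and eq: "\<And>y. y \<in> ball x d \<Longrightarrow> f y = g y \<and> f' y = g' y"
    using assms by metis
  have "(g has_derivative blinfun_apply (f' x)) (at x)"
    using g eq[of x] d by (simp add: C1_deriv_def)
  then have "(f has_derivative blinfun_apply (f' x)) (at x)"
    by (rule has_derivative_transform_within_open[of _ _ _ _ "ball x d"]) (use d eq in auto)
  moreover have "isCont f' x"
  proof -
    have "\<forall>\<^sub>F y in nhds x. f' y = g' y"
      unfolding eventually_nhds using eq d by (intro exI[of _ "ball x d"]) auto
    then have "isCont f' x \<longleftrightarrow> isCont g' x" by (rule isCont_cong)
    then show ?thesis
      using g by (simp add: C1_deriv_def)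
  qed
  ultimately show "(f has_derivative blinfun_apply (f' x)) (at x) \<and> isCont f' x" ..
qed

text \<open>Used with constant \<open>g\<close>: where a partition function vanishes on a ball, or
  where finitely many of them add up to 1, the derivative is 0.\<close>

lemma C1_deriv_cong_open:
  assumes "C1_deriv f f'" "C1_deriv g g'" "open U" "x \<in> U" "\<And>y. y \<in> U \<Longrightarrow> f y = g y"
  shows "f' x = g' x"
proof -
  have "(f has_derivative blinfun_apply (g' x)) (at x)"
    using assms(2) by (intro has_derivative_transform_within_open[of g _ _ _ U f])
      (use assms in \<open>auto simp: C1_deriv_def\<close>)
  moreover have "(f has_derivative blinfun_apply (f' x)) (at x)"
    using assms(1) by (simp add: C1_deriv_def)
  ultimately show ?thesis
    by (intro blinfun_eqI) (metis has_derivative_unique)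
qed

section \<open>Derivative bounds versus Lipschitz constants\<close>

lemma C1_deriv_imp_lipschitz:
  assumes "C1_deriv f f'" "\<And>x. norm (f' x) \<le> M" "0 \<le> M"
  shows "M-lipschitz_on UNIV f"
  by (rule bounded_derivative_imp_lipschitz[where f' = "\<lambda>x. blinfun_apply (f' x)"])
    (use assms in \<open>auto simp: C1_deriv_def norm_blinfun.rep_eq[symmetric]\<close>)

text \<open>The line \<open>x + t v\<close> stays in the subspace, and the difference quotients of
  \<open>f\<close> along it are bounded by \<open>M * norm v\<close>; the bound passes to the
  limit.\<close>

lemma derivative_le_lipschitz:
  fixes f :: "'a::real_normed_vector \<Rightarrow> real"
  assumes der: "(f has_derivative blinfun_apply T) (at x within Y)" and lip: "M-lipschitz_on Y f"
    and Y: "subspace Y" "x \<in> Y" "v \<in> Y"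
  shows "\<bar>T v\<bar> \<le> M * norm v"
proof -
  have inY: "x + t *\<^sub>R v \<in> Y" for t using Y by (intro subspace_add subspace_scale)
  have "((\<lambda>t. x + t *\<^sub>R v) has_derivative (\<lambda>t. t *\<^sub>R v)) (at 0)"
    by (auto intro!: derivative_eq_intros)
  moreover have "(f has_derivative blinfun_apply T) (at (x + 0 *\<^sub>R v) within range (\<lambda>t. x + t *\<^sub>R v))"
    using der inY by (auto intro: has_derivative_subset)
  ultimately have "((\<lambda>t. f (x + t *\<^sub>R v)) has_derivative (\<lambda>t. T (t *\<^sub>R v))) (at 0)"
    by (rule has_derivative_in_compose)
  moreover have "(\<lambda>t. T (t *\<^sub>R v)) = (*) (T v)"
    by (simp add: fun_eq_iff blinfun.scaleR_right)
  ultimately have "((\<lambda>t. f (x + t *\<^sub>R v)) has_real_derivative T v) (at 0)"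
    by (simp add: has_field_derivative_def)
  then have "((\<lambda>t. \<bar>(f (x + t *\<^sub>R v) - f x) / t\<bar>) \<longlongrightarrow> \<bar>T v\<bar>) (at 0)"
    by (intro tendsto_rabs) (simp add: DERIV_def)
  then show ?thesis
  proof (rule tendsto_upperbound)
    have "\<bar>(f (x + t *\<^sub>R v) - f x) / t\<bar> \<le> M * norm v" if "t \<noteq> 0" for t
    proof -
      have "\<bar>f (x + t *\<^sub>R v) - f x\<bar> \<le> M * (\<bar>t\<bar> * norm v)"
        using lipschitz_on_normD[OF lip inY[of t] Y(2)] by simp
      then show ?thesis using that by (simp add: divide_simps mult_ac)
    qed
    then show "\<forall>\<^sub>F t in at 0. \<bar>(f (x + t *\<^sub>R v) - f x) / t\<bar> \<le> M * norm v"
      by (auto simp: eventually_at intro!: exI[of _ 1])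
  qed simp
qed

section \<open>Lipschitz functions and property (*)\<close>

lemma Lip_le: "L-lipschitz_on U f \<Longrightarrow> Lip U f \<le> L"
  unfolding Lip_def by (rule cInf_lower) (auto intro!: bdd_belowI[of _ 0] dest: lipschitz_on_nonneg)

text \<open>Each quotient \<open>dist (f x) (f y) / dist x y\<close> is a lower bound of the
  admissible constants, hence at most their infimum; so the infimum is attained.\<close>

lemma lipschitz_on_Lip:
  assumes "lipschitz_fun U f"
  shows "(Lip U f)-lipschitz_on U f"
proof -
  from assms have ne: "{L. L-lipschitz_on U f} \<noteq> {}" by (auto simp: lipschitz_fun_def)
  have "dist (f x) (f y) \<le> Lip U f * dist x y" if "x \<in> U" "y \<in> U" for x y
  proof (cases "x = y")
    case False
    then have "dist (f x) (f y) / dist x y \<le> Lip U f"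
      unfolding Lip_def
      by (intro cInf_greatest ne) (use that lipschitz_onD in \<open>auto simp: divide_simps\<close>)
    then show ?thesis using False by (simp add: divide_simps)
  qed simp
  moreover have "0 \<le> Lip U f"
    unfolding Lip_def by (intro cInf_greatest ne) (auto dest: lipschitz_on_nonneg)
  ultimately show ?thesis by (intro lipschitz_onI) auto
qed

text \<open>McShane's extension: the infimum of the cones \<open>f a + L * dist x a\<close> over
  \<open>a \<in> A\<close>. The Lipschitz condition on \<open>A\<close> keeps it finite and makes
  the cone at \<open>x\<close> itself the lowest one when \<open>x \<in> A\<close>.\<close>

lemma lipschitz_extension:
  fixes f :: "'a::metric_space \<Rightarrow> real"
  assumes lip: "L-lipschitz_on A f"
  obtains g where "L-lipschitz_on UNIV g" "\<And>x. x \<in> A \<Longrightarrow> g x = f x"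
proof (cases "A = {}")
  case True
  have "L-lipschitz_on UNIV (\<lambda>x::'a. 0::real)"
    using lipschitz_on_nonneg[OF lip] by (intro lipschitz_onI) auto
  with True that show ?thesis by auto
next
  case False
  have L: "0 \<le> L" using lip by (rule lipschitz_on_nonneg)
  define g where "g x = (INF a\<in>A. f a + L * dist x a)" for x
  have f: "\<bar>f x - f y\<bar> \<le> L * dist x y" if "x \<in> A" "y \<in> A" for x y
    using lipschitz_onD[OF lip that] by (simp add: dist_real_def)
  obtain a0 where a0: "a0 \<in> A" using False by auto
  have bdd: "bdd_below ((\<lambda>a. f a + L * dist x a) ` A)" for x
  proof (rule bdd_belowI2)
    fix a assume "a \<in> A"
    have "L * dist a0 a \<le> L * dist x a0 + L * dist x a"
      using mult_left_mono[OF dist_triangle3[of a0 a x] L] by (simp add: distrib_left)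
    with f[OF a0 \<open>a \<in> A\<close>] show "f a0 - L * dist x a0 \<le> f a + L * dist x a" by linarith
  qed
  have low: "g x \<le> g y + L * dist x y" for x y
  proof -
    have "g x - L * dist x y \<le> f a + L * dist y a" if "a \<in> A" for a
    proof -
      have "g x \<le> f a + L * dist x a" unfolding g_def using that by (rule cINF_lower[OF bdd])
      also have "L * dist x a \<le> L * dist x y + L * dist y a"
        using mult_left_mono[OF dist_triangle[of x a y] L] by (simp add: distrib_left)
      finally show ?thesis by simp
    qed
    then have "g x - L * dist x y \<le> g y" unfolding g_def[of y] by (intro cINF_greatest False) auto
    then show ?thesis by simp
  qed
  have "L-lipschitz_on UNIV g"
  proof (rule lipschitz_onI[OF _ L])
    fix x y
    show "dist (g x) (g y) \<le> L * dist x y"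
      using low[of x y] low[of y x] by (simp add: dist_real_def dist_commute abs_le_iff)
  qed
  moreover have "g x = f x" if "x \<in> A" for x
  proof (rule antisym)
    show "g x \<le> f x" using cINF_lower[OF bdd[of x] that] by (simp add: g_def)
    show "f x \<le> g x" unfolding g_def
    proof (rule cINF_greatest[OF False])
      fix a assume "a \<in> A"
      from f[OF that this] show "f x \<le> f a + L * dist x a" by linarith
    qed
  qed
  ultimately show ?thesis by (rule that)
qed

definition C1_approximable :: "'a::real_normed_vector itself \<Rightarrow> real \<Rightarrow> bool" where
  "C1_approximable _ C \<longleftrightarrow> (\<forall>(f :: 'a \<Rightarrow> real) L \<epsilon>. L-lipschitz_on UNIV f \<longrightarrow> 0 < \<epsilon> \<longrightarrow>
     (\<exists>K K'. C1_deriv K K' \<and> (\<forall>x. norm (K' x) \<le> C * L \<and> \<bar>f x - K x\<bar> \<le> \<epsilon>)))"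

lemma C1_approximableE:
  fixes f :: "'a::real_normed_vector \<Rightarrow> real"
  assumes "C1_approximable TYPE('a) C" "L-lipschitz_on UNIV f" "0 < \<epsilon>"
  obtains K K' where "C1_deriv K K'" "\<And>x. norm (K' x) \<le> C * L" "\<And>x. \<bar>f x - K x\<bar> \<le> \<epsilon>"
  using assms unfolding C1_approximable_def by meson

lemma property_star_imp_C1_approximable:
  assumes "property_star TYPE('a::banach)"
  obtains C where "1 \<le> C" "C1_approximable TYPE('a) C"
proof -
  obtain C0 where C0: "\<And>(f :: 'a \<Rightarrow> real) \<epsilon>. lipschitz_fun UNIV f \<Longrightarrow> 0 < \<epsilon> \<Longrightarrow>
     \<exists>K. C1_smooth K \<and> lipschitz_fun UNIV K \<and> (\<forall>x. \<bar>f x - K x\<bar> < \<epsilon>) \<and> Lip UNIV K \<le> C0 * Lip UNIV f"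
    using assms unfolding property_star_def by blast
  \<comment> \<open>\<open>C0\<close> may be negative; the maximum with 1 makes the product monotone
    in \<open>Lip UNIV f \<le> L\<close> and secures \<open>1 \<le> C\<close>.\<close>
  have "C1_approximable TYPE('a) (max 1 C0)"
    unfolding C1_approximable_def
  proof (intro allI impI)
    fix f :: "'a \<Rightarrow> real" and L \<epsilon> :: real
    assume f: "L-lipschitz_on UNIV f" and "0 < \<epsilon>"
    then have lf: "lipschitz_fun UNIV f" by (auto simp: lipschitz_fun_def)
    obtain K K' where K: "C1_deriv K K'" "lipschitz_fun UNIV K" "\<And>x. \<bar>f x - K x\<bar> < \<epsilon>"
      "Lip UNIV K \<le> C0 * Lip UNIV f"
      using C0[OF lf \<open>0 < \<epsilon>\<close>] unfolding C1_smooth_iff by blast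
    have "0 \<le> Lip UNIV f" using lipschitz_on_Lip[OF lf] by (rule lipschitz_on_nonneg)
    then have "C0 * Lip UNIV f \<le> max 1 C0 * L"
      using Lip_le[OF f] by (intro mult_mono) auto
    with K(4) have lipK: "(max 1 C0 * L)-lipschitz_on UNIV K"
      using lipschitz_on_Lip[OF K(2)] by (meson lipschitz_on_mono order_trans subset_refl)
    then have "norm (K' x) \<le> max 1 C0 * L" for x
      using K(1) lipschitz_on_nonneg[OF lipK]
      by (intro norm_blinfun_bound)
        (auto simp: C1_deriv_def intro!: derivative_le_lipschitz[where Y = UNIV and x = x] lipK)
    with K show "\<exists>K K'. C1_deriv K K' \<and> (\<forall>x. norm (K' x) \<le> max 1 C0 * L \<and> \<bar>f x - K x\<bar> \<le> \<epsilon>)"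
      by (meson less_imp_le)
  qed
  then show ?thesis by (intro that[of "max 1 C0"]) auto
qed

section \<open>Norm-preserving extension of functionals\<close>

definition sublinear :: "('a::real_vector \<Rightarrow> real) \<Rightarrow> bool" where
  "sublinear p \<longleftrightarrow> (\<forall>x y. p (x + y) \<le> p x + p y) \<and> (\<forall>c x. 0 \<le> c \<longrightarrow> p (c *\<^sub>R x) = c * p x)"

text \<open>One inequality suffices for homogeneity: applied to \<open>1 / c\<close> and the vector
  \<open>c x\<close> it gives the reverse one.\<close>

lemma sublinearI:
  assumes "\<And>x y. p (x + y) \<le> p x + p y" "\<And>c x. 0 < c \<Longrightarrow> p (c *\<^sub>R x) \<le> c * p x" "p 0 = 0"
  shows "sublinear p"
  unfolding sublinear_def
proof (intro conjI allI impI)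
  fix c :: real and x :: 'a
  assume "0 \<le> c"
  show "p (c *\<^sub>R x) = c * p x"
  proof (cases "c = 0")
    case False
    with \<open>0 \<le> c\<close> have c: "0 < c" by simp
    have "p ((1 / c) *\<^sub>R (c *\<^sub>R x)) \<le> (1 / c) * p (c *\<^sub>R x)" using c by (intro assms) simp
    then have "c * p x \<le> p (c *\<^sub>R x)" using c by (simp add: divide_simps mult.commute)
    with assms(2)[OF c] show ?thesis by (simp add: antisym)
  qed (use assms in simp)
qed (rule assms)

lemma sublinear_lower: "sublinear p \<Longrightarrow> - p (- x) \<le> p x"
proof -
  assume p: "sublinear p"
  have "p (0 *\<^sub>R x) = 0 * p x" using p unfolding sublinear_def by (metis order_refl)
  moreover have "p (x + - x) \<le> p x + p (- x)" using p unfolding sublinear_def by blast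
  ultimately show ?thesis by simp
qed

text \<open>For fixed \<open>a\<close> the function
  \<open>q x = inf {p (x + t a) - t p a | t \<ge> 0}\<close> is sublinear and below
  \<open>p\<close>, so it equals \<open>p\<close>. Its candidate at \<open>t = 1\<close> then gives
  \<open>p x + p a \<le> p (x + a)\<close>, which together with subadditivity makes \<open>p\<close>
  additive.\<close>

lemma minimal_sublinear_linear:
  fixes p :: "'a::real_vector \<Rightarrow> real"
  assumes p: "sublinear p" and min: "\<And>q. sublinear q \<Longrightarrow> (\<And>x. q x \<le> p x) \<Longrightarrow> q = p"
  shows "linear p"
proof -
  have sub: "p (x + y) \<le> p x + p y" and hom: "0 \<le> c \<Longrightarrow> p (c *\<^sub>R x) = c * p x" for x y c
    using p unfolding sublinear_def by blast+
  have p0: "p 0 = 0" using hom[of 0] by simp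
  have super: "p x + p a \<le> p (x + a)" for x a
  proof -
    define q where "q x = (INF t\<in>{0..}. p (x + t *\<^sub>R a) - t * p a)" for x
    have low: "- p (- x) \<le> p (x + t *\<^sub>R a) - t * p a" if "0 \<le> t" for x t
      using sub[of "x + t *\<^sub>R a" "- x"] hom[OF that, of a] by simp
    have bdd: "bdd_below ((\<lambda>t. p (x + t *\<^sub>R a) - t * p a) ` {0..})" for x
      using low by (intro bdd_belowI2) auto
    have q_le: "q x \<le> p (x + t *\<^sub>R a) - t * p a" if "0 \<le> t" for x t
      unfolding q_def using that by (intro cINF_lower bdd) auto
    have q_less: "\<exists>t\<ge>0. p (x + t *\<^sub>R a) - t * p a < q x + e" if "0 < e" for x e
      using that cINF_less_iff[OF _ bdd[of x], of "q x + e"] unfolding q_def[symmetric] by auto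
    have "sublinear q"
    proof (rule sublinearI)
      fix x y
      show "q (x + y) \<le> q x + q y"
      proof (rule field_le_epsilon)
        fix e :: real assume "0 < e"
        obtain s where s: "0 \<le> s" "p (x + s *\<^sub>R a) - s * p a < q x + e / 2"
          using q_less[of "e / 2"] \<open>0 < e\<close> by auto
        obtain t where t: "0 \<le> t" "p (y + t *\<^sub>R a) - t * p a < q y + e / 2"
          using q_less[of "e / 2"] \<open>0 < e\<close> by auto
        have "q (x + y) \<le> p (x + y + (s + t) *\<^sub>R a) - (s + t) * p a"
          using s t by (intro q_le) simp
        also have "p (x + y + (s + t) *\<^sub>R a) \<le> p (x + s *\<^sub>R a) + p (y + t *\<^sub>R a)"
          using sub[of "x + s *\<^sub>R a" "y + t *\<^sub>R a"] by (simp add: algebra_simps)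
        finally show "q (x + y) \<le> q x + q y + e" using s t by (simp add: algebra_simps)
      qed
    next
      fix c :: real and x assume c: "0 < c"
      show "q (c *\<^sub>R x) \<le> c * q x"
      proof (rule field_le_epsilon)
        fix e :: real assume "0 < e"
        obtain t where t: "0 \<le> t" "p (x + t *\<^sub>R a) - t * p a < q x + e / c"
          using q_less[of "e / c"] \<open>0 < e\<close> c by auto
        have "q (c *\<^sub>R x) \<le> p (c *\<^sub>R x + (c * t) *\<^sub>R a) - (c * t) * p a"
          using t c by (intro q_le) simp
        also have "\<dots> = c * (p (x + t *\<^sub>R a) - t * p a)"
          using hom[of c "x + t *\<^sub>R a"] c by (simp add: algebra_simps)
        also have "\<dots> \<le> c * (q x + e / c)" using t c by (intro mult_left_mono) auto
        finally show "q (c *\<^sub>R x) \<le> c * q x + e" using c by (simp add: distrib_left)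
      qed
    next
      have "0 \<le> q 0" unfolding q_def using low[of _ 0] p0 by (intro cINF_greatest) auto
      with q_le[of 0 0] p0 show "q 0 = 0" by simp
    qed
    moreover have "q x \<le> p x" for x using q_le[of 0 x] by simp
    ultimately have "q = p" by (rule min)
    then show ?thesis using q_le[of 1 x] by simp
  qed
  show ?thesis
  proof (rule linearI)
    show add: "p (x + y) = p x + p y" for x y
      using sub super by (simp add: antisym)
    have neg: "p (- x) = - p x" for x using add[of x "- x"] p0 by simp
    show "p (c *\<^sub>R x) = c *\<^sub>R p x" for c x
      using hom[of c x] hom[of "- c" x] neg[of "c *\<^sub>R x"] by (cases "0 \<le> c") auto
  qed
qed

text \<open>The Hahn-Banach theorem by Zorn's lemma: the pointwise infimum of a chain of sublinear
  functions below \<open>p\<close> is again sublinear, and is finite because all of them lie above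
  \<open>- p (- x)\<close>.\<close>

lemma linear_below_sublinear:
  fixes p :: "'a::real_vector \<Rightarrow> real"
  assumes p: "sublinear p"
  obtains T where "linear T" "\<And>x. T x \<le> p x"
proof -
  define A where "A = {q. sublinear q \<and> (\<forall>x. q x \<le> p x)}"
  \<comment> \<open>The pointwise order reversed, so that the maximal element from Zorn's lemma is a
    minimal sublinear function.\<close>
  define P where "P q r \<longleftrightarrow> (\<forall>x::'a. r x \<le> (q x :: real))" for q r
  have po: "partial_order_on A (relation_of P A)"
    by (rule partial_order_on_relation_ofI) (auto simp: P_def fun_eq_iff intro: order_trans antisym)
  have "\<exists>u\<in>A. \<forall>q\<in>D. P q u" if D: "D \<in> Chains (relation_of P A)" for D
  proof (cases "D = {}")
    case True
    then show ?thesis using p by (auto simp: A_def)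
  next
    case False
    have DA: "q \<in> A" if "q \<in> D" for q
      using D that unfolding Chains_def relation_of_def by auto
    have Dch: "P q r \<or> P r q" if "q \<in> D" "r \<in> D" for q r
      using D that unfolding Chains_def relation_of_def by auto
    have D_add: "q (x + y) \<le> q x + q y" and D_hom: "0 \<le> c \<Longrightarrow> q (c *\<^sub>R x) = c * q x"
      if "q \<in> D" for q x y c
      using DA[OF that] unfolding A_def sublinear_def by blast+
    have low: "- p (- x) \<le> q x" if "q \<in> D" for q x
    proof -
      have "q (- x) \<le> p (- x)" "- q (- x) \<le> q x"
        using DA[OF that] sublinear_lower[of q x] by (auto simp: A_def)
      then show ?thesis by linarith
    qed
    define u where "u x = (INF q\<in>D. q x)" for x
    have bdd: "bdd_below ((\<lambda>q. q x) ` D)" for x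
      using low by (intro bdd_belowI2)
    have u_le: "u x \<le> q x" if "q \<in> D" for q x
      unfolding u_def using that by (intro cINF_lower bdd)
    have u_less: "\<exists>q\<in>D. q x < u x + e" if "0 < e" for x e
      using that cINF_less_iff[OF False bdd[of x], of "u x + e"] unfolding u_def[symmetric] by auto
    have "sublinear u"
    proof (rule sublinearI)
      fix x y
      show "u (x + y) \<le> u x + u y"
      proof (rule field_le_epsilon)
        fix e :: real assume "0 < e"
        obtain q where q: "q \<in> D" "q x < u x + e / 2" using u_less[of "e / 2"] \<open>0 < e\<close> by auto
        obtain r where r: "r \<in> D" "r y < u y + e / 2" using u_less[of "e / 2"] \<open>0 < e\<close> by auto
        \<comment> \<open>In a chain the smaller of \<open>q\<close> and \<open>r\<close> is nearly
          optimal at \<open>x\<close> and at \<open>y\<close> simultaneously.\<close>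
        obtain s where s: "s \<in> D" "s x \<le> q x" "s y \<le> r y"
          using Dch[OF q(1) r(1)] q(1) r(1) unfolding P_def by blast
        have "u (x + y) \<le> s x + s y" using u_le[OF s(1), of "x + y"] D_add[OF s(1), of x y] by linarith
        then show "u (x + y) \<le> u x + u y + e" using s q r by simp
      qed
    next
      fix c :: real and x assume c: "0 < c"
      show "u (c *\<^sub>R x) \<le> c * u x"
      proof (rule field_le_epsilon)
        fix e :: real assume "0 < e"
        obtain q where q: "q \<in> D" "q x < u x + e / c" using u_less[of "e / c"] \<open>0 < e\<close> c by auto
        have "u (c *\<^sub>R x) \<le> c * q x" using u_le[OF q(1), of "c *\<^sub>R x"] D_hom[OF q(1)] c by simp
        also have "\<dots> \<le> c * (u x + e / c)" using q c by (intro mult_left_mono) auto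
        finally show "u (c *\<^sub>R x) \<le> c * u x + e" using c by (simp add: distrib_left)
      qed
    next
      have "q 0 = 0" if "q \<in> D" for q using D_hom[OF that, of 0] by simp
      then have "(\<lambda>q. q 0) ` D = {0}" using False by force
      then show "u 0 = 0" unfolding u_def by simp
    qed
    moreover have "u x \<le> p x" for x
      using False u_le[of _ x] DA unfolding A_def by (auto intro: order_trans)
    ultimately show ?thesis using u_le by (auto simp: A_def P_def)
  qed
  from predicate_Zorn[OF po this] obtain m where m: "m \<in> A"
    and mmin: "\<And>q. q \<in> A \<Longrightarrow> P m q \<Longrightarrow> q = m" by blast
  have "linear m"
  proof (rule minimal_sublinear_linear)
    show "sublinear m" using m by (simp add: A_def)
    fix q :: "'a \<Rightarrow> real" assume q: "sublinear q" "\<And>x. q x \<le> m x"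
    show "q = m"
      using q m by (intro mmin) (auto simp: A_def P_def intro: order_trans)
  qed
  with m show ?thesis by (intro that) (auto simp: A_def)
qed

text \<open>Applied to \<open>p x = inf {T y + L \<bar>x - y\<bar> | y \<in> Y}\<close>, a linear functional below \<open>p\<close> is
  \<open>\<le> T\<close> on the subspace, hence equal to \<open>T\<close> there, and has norm at most \<open>L\<close>.\<close>

lemma functional_extension:
  fixes T :: "'a::real_normed_vector \<Rightarrow>\<^sub>L real"
  assumes Y: "subspace Y" and T: "\<And>v. v \<in> Y \<Longrightarrow> \<bar>T v\<bar> \<le> L * norm v" and L: "0 \<le> L"
  obtains S :: "'a \<Rightarrow>\<^sub>L real" where "\<And>v. v \<in> Y \<Longrightarrow> S v = T v" "norm S \<le> L"
proof -
  have Y0: "0 \<in> Y" and ne: "Y \<noteq> {}" using Y subspace_0 by auto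
  define p where "p x = (INF y\<in>Y. T y + L * norm (x - y))" for x
  have low: "- L * norm x \<le> T y + L * norm (x - y)" if "y \<in> Y" for x y
  proof -
    have "L * norm y \<le> L * norm x + L * norm (x - y)"
      using mult_left_mono[OF norm_triangle_sub[of y x] L] by (simp add: distrib_left norm_minus_commute)
    with T[OF that] show ?thesis by (simp add: abs_le_iff)
  qed
  have bdd: "bdd_below ((\<lambda>y. T y + L * norm (x - y)) ` Y)" for x
    using low by (intro bdd_belowI2)
  have p_le: "p x \<le> T y + L * norm (x - y)" if "y \<in> Y" for x y
    unfolding p_def using that by (intro cINF_lower bdd)
  have p_less: "\<exists>y\<in>Y. T y + L * norm (x - y) < p x + e" if "0 < e" for x e
    using that cINF_less_iff[OF ne bdd[of x], of "p x + e"] unfolding p_def[symmetric] by auto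
  have "sublinear p"
  proof (rule sublinearI)
    fix x y
    show "p (x + y) \<le> p x + p y"
    proof (rule field_le_epsilon)
      fix e :: real assume "0 < e"
      obtain u where u: "u \<in> Y" "T u + L * norm (x - u) < p x + e / 2"
        using p_less[of "e / 2"] \<open>0 < e\<close> by auto
      obtain v where v: "v \<in> Y" "T v + L * norm (y - v) < p y + e / 2"
        using p_less[of "e / 2"] \<open>0 < e\<close> by auto
      have "p (x + y) \<le> T (u + v) + L * norm (x + y - (u + v))"
        using u v Y by (intro p_le subspace_add)
      also have "L * norm (x + y - (u + v)) \<le> L * norm (x - u) + L * norm (y - v)"
        using mult_left_mono[OF norm_triangle_ineq[of "x - u" "y - v"] L]
        by (simp add: distrib_left algebra_simps)
      finally show "p (x + y) \<le> p x + p y + e" using u v by (simp add: blinfun.add_right)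
    qed
  next
    fix c :: real and x assume c: "0 < c"
    show "p (c *\<^sub>R x) \<le> c * p x"
    proof (rule field_le_epsilon)
      fix e :: real assume "0 < e"
      obtain u where u: "u \<in> Y" "T u + L * norm (x - u) < p x + e / c"
        using p_less[of "e / c"] \<open>0 < e\<close> c by auto
      have "p (c *\<^sub>R x) \<le> T (c *\<^sub>R u) + L * norm (c *\<^sub>R x - c *\<^sub>R u)"
        using u Y by (intro p_le subspace_scale)
      also have "\<dots> = c * (T u + L * norm (x - u))"
        using c norm_scaleR[of c "x - u"]
        by (simp add: blinfun.scaleR_right distrib_left scaleR_diff_right)
      also have "\<dots> \<le> c * (p x + e / c)" using u c by (intro mult_left_mono) auto
      finally show "p (c *\<^sub>R x) \<le> c * p x + e" using c by (simp add: distrib_left)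
    qed
  next
    have "0 \<le> p 0" unfolding p_def using low[of _ 0] by (intro cINF_greatest ne) auto
    with p_le[OF Y0, of 0] show "p 0 = 0" by (simp add: blinfun.zero_right)
  qed
  then obtain S where S: "linear S" "\<And>x. S x \<le> p x" by (rule linear_below_sublinear) blast
  have upper: "S x \<le> L * norm x" for x
    using S(2)[of x] p_le[OF Y0, of x] by (simp add: blinfun.zero_right)
  have abs_le: "\<bar>S x\<bar> \<le> L * norm x" for x
    using upper[of x] upper[of "- x"] linear_neg[OF S(1), of x] by (simp add: abs_le_iff)
  have bl: "bounded_linear S"
    using S(1) abs_le by (intro bounded_linear_intro[where K = L])
      (auto simp: linear_add linear_scale mult.commute)
  have le: "S v \<le> T v" if "v \<in> Y" for v
    using S(2)[of v] p_le[OF that, of v] by simp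
  show ?thesis
  proof (rule that[of "Blinfun S"])
    show "blinfun_apply (Blinfun S) v = T v" if "v \<in> Y" for v
      using le[OF that] le[OF subspace_neg[OF Y that]] linear_neg[OF S(1), of v]
      by (simp add: bounded_linear_Blinfun_apply[OF bl] blinfun.minus_right)
    show "norm (Blinfun S) \<le> L"
      using abs_le L by (intro norm_blinfun_bound) (auto simp: bounded_linear_Blinfun_apply[OF bl])
  qed
qed

section \<open>Partitions of unity\<close>

lemma max0_square_derivative:
  "((\<lambda>s::real. (max 0 s)\<^sup>2) has_real_derivative 2 * max 0 t) (at t)"
proof (cases "t = 0")
  case True
  have "((\<lambda>h::real. max 0 h) \<longlongrightarrow> max 0 0) (at 0)" by (intro tendsto_intros)
  moreover have "\<forall>\<^sub>F h::real in at 0. ((max 0 (0 + h))\<^sup>2 - (max 0 0)\<^sup>2) / h = max 0 h"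
    by (auto simp: eventually_at power2_eq_square max_def intro!: exI[of _ 1])
  ultimately show ?thesis
    using True unfolding DERIV_def by (simp add: tendsto_cong)
next
  case False
  then consider "t < 0" | "0 < t" by linarith
  then show ?thesis
  proof cases
    case 1
    have "((\<lambda>s. 0) has_real_derivative 2 * max 0 t) (at t)" using 1 by simp
    then show ?thesis
      by (rule has_field_derivative_transform_within_open[of _ _ _ "{..<0}"]) (use 1 in auto)
  next
    case 2
    have "((\<lambda>s. s\<^sup>2) has_real_derivative 2 * max 0 t) (at t)"
      using 2 by (auto intro!: derivative_eq_intros)
    then show ?thesis
      by (rule has_field_derivative_transform_within_open[of _ _ _ "{0<..}"]) (use 2 in auto)
  qed
qed

text \<open>Squares of positive parts are C^1 and join the two plateaus. With
  \<open>m = max 0 (t - 1/4)\<close> the factor 4 makes \<open>1 - 4 m^2\<close> vanish at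
  \<open>m = 1/2\<close>, that is at \<open>t = 3/4\<close>; the derivative has modulus
  \<open>16 m max 0 (1 - 4 m^2)\<close>, and \<open>m max 0 (1 - 4 m^2) \<le> 1/2\<close> gives
  8.\<close>

lemma smooth_step:
  obtains u u' :: "real \<Rightarrow> real"
  where "\<And>t. (u has_real_derivative u' t) (at t)" "\<And>t. isCont u' t"
    "\<And>t. 0 \<le> u t \<and> u t \<le> 1" "\<And>t. \<bar>u' t\<bar> \<le> 8"
    "\<And>t. t \<le> 1/4 \<Longrightarrow> u t = 1" "\<And>t. 3/4 \<le> t \<Longrightarrow> u t = 0"
proof
  let ?p = "\<lambda>s::real. (max 0 s)\<^sup>2" and ?q = "\<lambda>s::real. 2 * max 0 s"
  let ?u = "\<lambda>t. ?p (1 - 4 * ?p (t - 1/4))"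
  let ?u' = "\<lambda>t. ?q (1 - 4 * ?p (t - 1/4)) * (- 4 * ?q (t - 1/4))"
  show "(?u has_real_derivative ?u' t) (at t)" for t
  proof -
    have "((\<lambda>t. ?p (t - 1/4)) has_real_derivative ?q (t - 1/4) * 1) (at t)"
      by (rule DERIV_chain2[OF max0_square_derivative, of "\<lambda>t. t - 1/4"]) (auto intro!: derivative_eq_intros)
    then have "((\<lambda>t. 1 - 4 * ?p (t - 1/4)) has_real_derivative - 4 * ?q (t - 1/4)) (at t)"
      using DERIV_diff[OF DERIV_const[of 1] DERIV_cmult[of _ _ _ UNIV 4]] by fastforce
    then show ?thesis by (rule DERIV_chain2[OF max0_square_derivative])
  qed
  show "isCont ?u' t" for t by (intro continuous_intros)
  show "0 \<le> ?u t \<and> ?u t \<le> 1" for t by (auto simp: power_le_one)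
  show "\<bar>?u' t\<bar> \<le> 8" for t
  proof -
    define m where "m = max 0 (t - 1/4)"
    have m: "0 \<le> m" by (simp add: m_def)
    have "max 0 (1 - 4 * m\<^sup>2) * m \<le> 1 / 2"
    proof (cases "m \<le> 1/2")
      case True
      have "max 0 (1 - 4 * m\<^sup>2) * m \<le> 1 * (1/2)" using m True by (intro mult_mono) auto
      then show ?thesis by simp
    next
      case False
      then have "(1/2)\<^sup>2 \<le> m\<^sup>2" by (intro power_mono) auto
      then show ?thesis by (simp add: power2_eq_square)
    qed
    then show ?thesis using m unfolding m_def[symmetric] by (simp add: abs_mult mult_ac)
  qed
  show "?u t = 1" if "t \<le> 1/4" for t using that by simp
  show "?u t = 0" if "3/4 \<le> t" for t
  proof -
    have "(1/2)\<^sup>2 \<le> (max 0 (t - 1/4))\<^sup>2" using that by (intro power_mono) auto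
    then show ?thesis by (simp add: power2_eq_square)
  qed
qed

text \<open>The scaled distance \<open>infdist x A / \<rho>\<close> is smoothed up to an error of
  1/8 and fed to the step function. Distance below \<open>\<rho> / 8\<close> gives a value of at
  most 1/4, distance at least \<open>\<rho>\<close> a value of at least 7/8, so both plateaus are
  reached.\<close>

lemma C1_bump:
  fixes A :: "'a::real_normed_vector set"
  assumes C: "C1_approximable TYPE('a) C" and \<rho>: "0 < \<rho>"
  obtains \<psi> \<psi>' B where "C1_deriv \<psi> \<psi>'" "\<And>x. 0 \<le> \<psi> x \<and> \<psi> x \<le> 1" "\<And>x. norm (\<psi>' x) \<le> B"
    "\<And>x a. a \<in> A \<Longrightarrow> dist x a < \<rho> / 8 \<Longrightarrow> \<psi> x = 1"
    "\<And>x. \<psi> x \<noteq> 0 \<Longrightarrow> \<exists>a\<in>A. dist x a < \<rho>"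
proof (cases "A = {}")
  case True
  then show ?thesis
    by (intro that[of "\<lambda>x. 0" "\<lambda>x. 0" 0]) (auto intro: C1_deriv_const)
next
  case False
  have "(1 / \<rho>)-lipschitz_on UNIV (\<lambda>x. infdist x A / \<rho>)"
  proof (rule lipschitz_onI)
    fix x y
    have "\<bar>infdist x A - infdist y A\<bar> \<le> dist x y" by (rule infdist_triangle_abs)
    then show "dist (infdist x A / \<rho>) (infdist y A / \<rho>) \<le> 1 / \<rho> * dist x y"
      using \<rho> by (simp add: dist_real_def diff_divide_distrib[symmetric] divide_right_mono)
  qed (use \<rho> in simp)
  then obtain K K' where K: "C1_deriv K K'" and KL: "\<And>x. norm (K' x) \<le> C * (1 / \<rho>)"
    and Ka: "\<And>x. \<bar>infdist x A / \<rho> - K x\<bar> \<le> 1 / 8"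
    by (rule C1_approximableE[OF C, where \<epsilon> = "1/8"]) auto
  obtain u u' :: "real \<Rightarrow> real" where u: "\<And>t. (u has_real_derivative u' t) (at t)" "\<And>t. isCont u' t"
    "\<And>t. 0 \<le> u t \<and> u t \<le> 1" "\<And>t. \<bar>u' t\<bar> \<le> 8"
    "\<And>t. t \<le> 1/4 \<Longrightarrow> u t = 1" "\<And>t. 3/4 \<le> t \<Longrightarrow> u t = 0"
    by (rule smooth_step) blast
  show ?thesis
  proof (rule that[OF C1_deriv_compose[OF K u(1,2)]])
    show "0 \<le> u (K x) \<and> u (K x) \<le> 1" for x by (rule u)
    show "norm (u' (K x) *\<^sub>R K' x) \<le> 8 * (C * (1 / \<rho>))" for x
      unfolding norm_scaleR using u(4) KL by (intro mult_mono) auto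
    show "u (K x) = 1" if "a \<in> A" "dist x a < \<rho> / 8" for x a
    proof (rule u)
      have "infdist x A / \<rho> \<le> 1 / 8"
        using infdist_le[OF that(1), of x] that(2) \<rho> by (simp add: divide_simps)
      with Ka[of x] show "K x \<le> 1/4" by linarith
    qed
    show "\<exists>a\<in>A. dist x a < \<rho>" if "u (K x) \<noteq> 0" for x
    proof (rule ccontr)
      assume "\<not> (\<exists>a\<in>A. dist x a < \<rho>)"
      then have "\<rho> \<le> infdist x A" unfolding infdist_notempty[OF False]
        by (intro cINF_greatest False) (auto simp: not_less)
      then have "1 \<le> infdist x A / \<rho>" using \<rho> by simp
      with Ka[of x] have "3/4 \<le> K x" by linarith
      with u(6) that show False by blast
    qed
  qed
qed

lemma well_order_min:
  obtains R :: "'a rel" where "\<And>Q. Q \<noteq> {} \<Longrightarrow> \<exists>s\<in>Q. \<forall>t\<in>Q. (s, t) \<in> R" "antisym R"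
proof -
  from well_ordering obtain R :: "'a rel" where "Well_order R \<and> Field R = UNIV" ..
  then have R: "well_order_on UNIV R" by auto
  then have "refl R" "total R" "antisym R"
    unfolding well_order_on_def linear_order_on_def partial_order_on_def preorder_on_def by simp_all
  then have tot: "(s, t) \<in> R \<or> (t, s) \<in> R" for s t
    by (cases "s = t") (auto simp: refl_on_def total_on_def)
  have "\<exists>s\<in>Q. \<forall>t\<in>Q. (s, t) \<in> R" if Q: "Q \<noteq> {}" for Q
  proof -
    have "wf (R - Id)" using R by (simp add: well_order_on_def)
    from wfE_min'[OF this Q] obtain s where "s \<in> Q" "\<And>t. (t, s) \<in> R - Id \<Longrightarrow> t \<notin> Q" by blast
    then show ?thesis using tot by blast
  qed
  then show ?thesis using \<open>antisym R\<close> by (rule that)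
qed

text \<open>Stone's argument.  Let \<open>a x\<close> be the least centre \<open>s\<close> with \<open>x \<in> ball s (r s)\<close> and let \<open>A n\<close> be
  the set of points of depth \<open>\<ge> 3 \<rho>\<^sub>n\<close> in the ball around \<open>a x\<close>.  Points of \<open>A n\<close> with different
  values of \<open>a\<close> are at distance \<open>\<ge> 3 \<rho>\<^sub>n\<close>, so \<open>a\<close> extends to a locally constant function near \<open>A n\<close>.
  Multiplying the bump \<open>\<psi>\<^sub>n\<close> of \<open>A n\<close> by \<open>\<Prod>k<n. 1 - \<psi>\<^sub>k\<close> makes the sum telescope and the family
  locally finite.\<close>

lemma C1_partition_of_unity:
  fixes r :: "'a::real_normed_vector \<Rightarrow> real"
  assumes C: "C1_approximable TYPE('a) C" and r: "\<And>s. 0 < r s"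
  obtains \<phi> :: "nat \<Rightarrow> 'a \<Rightarrow> real" and \<phi>' B and b :: "nat \<Rightarrow> 'a \<Rightarrow> 'a"
  where "\<And>n. C1_deriv (\<phi> n) (\<phi>' n)" "\<And>n x. 0 \<le> \<phi> n x" "\<And>n x. norm (\<phi>' n x) \<le> B n"
    "\<And>x. \<exists>d>0. \<exists>N. \<forall>y\<in>ball x d. (\<Sum>n<N. \<phi> n y) = 1 \<and> (\<forall>n\<ge>N. \<phi> n y = 0)"
    "\<And>n x. \<exists>d>0. (\<forall>y\<in>ball x d. \<phi> n y = 0) \<or>
       (\<forall>y\<in>ball x d. b n y = b n x \<and> y \<in> ball (b n x) (r (b n x)))"
proof -
  obtain R :: "'a rel" where R: "\<And>Q. Q \<noteq> {} \<Longrightarrow> \<exists>s\<in>Q. \<forall>t\<in>Q. (s, t) \<in> R" "antisym R"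
    by (rule well_order_min) blast
  have "\<exists>s. x \<in> ball s (r s) \<and> (\<forall>t. x \<in> ball t (r t) \<longrightarrow> (s, t) \<in> R)" for x
    using R(1)[of "{s. x \<in> ball s (r s)}"] r[of x] by (metis (mono_tags) centre_in_ball empty_iff mem_Collect_eq)
  then obtain a where a: "\<And>x. x \<in> ball (a x) (r (a x))"
    and amin: "\<And>x t. x \<in> ball t (r t) \<Longrightarrow> (a x, t) \<in> R" by metis
  define \<rho> where "\<rho> n = inverse (real (Suc n))" for n
  have \<rho>: "0 < \<rho> n" for n by (simp add: \<rho>_def)
  define A where "A n = {x. ball x (3 * \<rho> n) \<subseteq> ball (a x) (r (a x))}" for n
  have sep: "a x = a y" if "x \<in> A n" "y \<in> A n" "dist x y < 3 * \<rho> n" for x y n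
  proof -
    have "y \<in> ball (a x) (r (a x))" "x \<in> ball (a y) (r (a y))"
      using that by (auto simp: A_def dist_commute subset_iff)
    then show ?thesis using amin R(2) by (meson antisymD)
  qed
  have cover: "\<exists>n. x \<in> A n" for x
  proof -
    obtain e where e: "0 < e" "ball x e \<subseteq> ball (a x) (r (a x))"
      using a[of x] open_contains_ball by (metis open_ball)
    obtain n where "inverse (real (Suc n)) < e / 3" using reals_Archimedean[of "e / 3"] e by auto
    then have "ball x (3 * \<rho> n) \<subseteq> ball x e" by (intro subset_ball) (simp add: \<rho>_def)
    with e show ?thesis by (auto simp: A_def)
  qed
  have "\<exists>b. \<forall>z x. x \<in> A n \<longrightarrow> dist z x < \<rho> n \<longrightarrow> b z = a x" for n
  proof -
    \<comment> \<open>Two points of \<open>A n\<close> within \<open>\<rho> n\<close> of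
      \<open>z\<close> are less than \<open>2 \<rho> n\<close> apart, so \<open>sep\<close> gives
      them the same centre; if there is no such point, any \<open>c\<close> will do.\<close>
    have "\<exists>c. \<forall>x. x \<in> A n \<longrightarrow> dist z x < \<rho> n \<longrightarrow> c = a x" for z
    proof (cases "\<exists>x0\<in>A n. dist z x0 < \<rho> n")
      case True
      then obtain x0 where x0: "x0 \<in> A n" "dist z x0 < \<rho> n" by blast
      have "a x0 = a x" if "x \<in> A n" "dist z x < \<rho> n" for x
        using dist_triangle3[of x0 x z] x0(2) that(2) \<rho>[of n] by (intro sep[OF x0(1) that(1)]) linarith
      then show ?thesis by blast
    qed blast
    then show ?thesis by (intro choice) blast
  qed
  then obtain b where b: "\<And>n z x. x \<in> A n \<Longrightarrow> dist z x < \<rho> n \<Longrightarrow> b n z = a x" by metis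
  \<comment> \<open>The radius is \<open>\<rho> n / 2\<close> although \<open>b n\<close> is
    controlled up to \<open>\<rho> n\<close>: this margin gives every point a ball on which either
    \<open>b n\<close> is constant or the n-th function vanishes.\<close>
  have "\<exists>\<psi> \<psi>' B. C1_deriv \<psi> \<psi>' \<and> (\<forall>x. 0 \<le> \<psi> x \<and> \<psi> x \<le> 1) \<and> (\<forall>x. norm (\<psi>' x) \<le> B) \<and>
      (\<forall>x y. y \<in> A n \<longrightarrow> dist x y < \<rho> n / 2 / 8 \<longrightarrow> \<psi> x = 1) \<and>
      (\<forall>x. \<psi> x \<noteq> 0 \<longrightarrow> (\<exists>y\<in>A n. dist x y < \<rho> n / 2))" for n
    by (rule C1_bump[OF C, of "\<rho> n / 2" "A n"]) (use \<rho>[of n] in \<open>simp, blast\<close>)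
  then obtain \<psi> \<psi>' B where \<psi>: "\<And>n. C1_deriv (\<psi> n) (\<psi>' n)" "\<And>n x. 0 \<le> \<psi> n x" "\<And>n x. \<psi> n x \<le> 1"
    "\<And>n x. norm (\<psi>' n x) \<le> B n" and \<psi>1: "\<And>n x y. y \<in> A n \<Longrightarrow> dist x y < \<rho> n / 2 / 8 \<Longrightarrow> \<psi> n x = 1"
    and \<psi>0: "\<And>n x. \<psi> n x \<noteq> 0 \<Longrightarrow> \<exists>y\<in>A n. dist x y < \<rho> n / 2"
    by metis
  define P where "P n x = (\<Prod>k<n. 1 - \<psi> k x)" for n x
  have P01: "0 \<le> P n x" "P n x \<le> 1" for n x
    using \<psi>(2,3) unfolding P_def by (auto intro!: prod_nonneg prod_le_1)
  have P_Suc: "P n x - P (Suc n) x = \<psi> n x * P n x" for n x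
    by (simp add: P_def algebra_simps)
  have "\<exists>P' D. C1_deriv (P n) P' \<and> (\<forall>x. norm (P' x) \<le> D)" for n
  proof (induction n)
    case 0
    have "P 0 = (\<lambda>x. 1)" by (simp add: P_def fun_eq_iff)
    then show ?case using C1_deriv_const[of 1] by (metis norm_zero order_refl)
  next
    case (Suc n)
    then obtain P' D where P': "C1_deriv (P n) P'" "\<And>x. norm (P' x) \<le> D" by blast
    have eq: "P (Suc n) = (\<lambda>x. P n x * (1 - \<psi> n x))" by (simp add: P_def fun_eq_iff)
    have "norm (P n x *\<^sub>R (0 - \<psi>' n x) + (1 - \<psi> n x) *\<^sub>R P' x) \<le> 1 * B n + 1 * D" for x
    proof -
      have "norm (P n x *\<^sub>R (0 - \<psi>' n x)) \<le> 1 * B n"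
        unfolding norm_scaleR using P01 \<psi> by (intro mult_mono) auto
      moreover have "norm ((1 - \<psi> n x) *\<^sub>R P' x) \<le> 1 * D"
        unfolding norm_scaleR using P'(2) \<psi>(2,3) by (intro mult_mono) auto
      ultimately show ?thesis by (rule norm_triangle_mono)
    qed
    moreover have "C1_deriv (P (Suc n)) (\<lambda>x. P n x *\<^sub>R (0 - \<psi>' n x) + (1 - \<psi> n x) *\<^sub>R P' x)"
      unfolding eq by (intro C1_deriv_mult C1_deriv_diff C1_deriv_const P' \<psi>)
    ultimately show ?case by blast
  qed
  then obtain P' D where P': "\<And>n. C1_deriv (P n) (P' n)" "\<And>n x. norm (P' n x) \<le> D n" by metis
  define \<phi> where "\<phi> n x = P n x - P (Suc n) x" for n x
  show ?thesis
  proof (rule that[of \<phi> "\<lambda>n x. P' n x - P' (Suc n) x" "\<lambda>n. D n + D (Suc n)" b])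
    show "C1_deriv (\<phi> n) (\<lambda>x. P' n x - P' (Suc n) x)" for n
      unfolding \<phi>_def by (intro C1_deriv_diff P')
    show "0 \<le> \<phi> n x" for n x unfolding \<phi>_def P_Suc using \<psi> P01 by simp
    show "norm (P' n x - P' (Suc n) x) \<le> D n + D (Suc n)" for n x
      using P'(2) norm_triangle_le_diff add_mono by blast
    show "\<exists>d>0. \<exists>N. \<forall>y\<in>ball x d. (\<Sum>n<N. \<phi> n y) = 1 \<and> (\<forall>n\<ge>N. \<phi> n y = 0)" for x
    proof -
      obtain m where m: "x \<in> A m" using cover by blast
      \<comment> \<open>Near \<open>x\<close> the factor \<open>1 - \<psi> m\<close> is zero and
        kills every later product.\<close>
      have P0: "P n y = 0" if "y \<in> ball x (\<rho> m / 2 / 8)" "Suc m \<le> n" for y n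
      proof -
        have "\<psi> m y = 1" using \<psi>1[OF m] that(1) by (simp add: dist_commute)
        then show ?thesis unfolding P_def using that(2) by (intro prod_zero) auto
      qed
      have "(\<Sum>n<Suc m. \<phi> n y) = P 0 y - P (Suc m) y" for y
        unfolding \<phi>_def by (rule sum_lessThan_telescope')
      then have "(\<Sum>n<Suc m. \<phi> n y) = 1 \<and> (\<forall>n\<ge>Suc m. \<phi> n y = 0)" if "y \<in> ball x (\<rho> m / 2 / 8)" for y
        using P0[OF that] by (simp add: \<phi>_def) (simp add: P_def)
      moreover have "0 < \<rho> m / 2 / 8" using \<rho>[of m] by simp
      ultimately show ?thesis by blast
    qed
    show "\<exists>d>0. (\<forall>y\<in>ball x d. \<phi> n y = 0) \<or>
        (\<forall>y\<in>ball x d. b n y = b n x \<and> y \<in> ball (b n x) (r (b n x)))" for n x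
    proof (cases "\<exists>z\<in>A n. dist x z < \<rho> n")
      case True
      then obtain z where z: "z \<in> A n" "dist x z < \<rho> n" by blast
      define d where "d = \<rho> n - dist x z"
      have "b n y = b n x \<and> y \<in> ball (b n x) (r (b n x))" if "y \<in> ball x d" for y
      proof -
        have yz: "dist y z < \<rho> n"
          using that dist_triangle[of y z x] by (simp add: d_def dist_commute)
        then have "b n y = a z" "b n x = a z" using b z by auto
        moreover have "y \<in> ball z (3 * \<rho> n)" using yz \<rho>[of n] by (simp add: dist_commute)
        ultimately show ?thesis using z(1) by (auto simp: A_def)
      qed
      moreover have "0 < d" using z by (simp add: d_def)
      ultimately show ?thesis by blast
    next
      case False
      have "\<phi> n y = 0" if "y \<in> ball x (\<rho> n / 2)" for y
      proof (rule ccontr)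
        assume "\<phi> n y \<noteq> 0"
        then have "\<psi> n y \<noteq> 0" by (auto simp: \<phi>_def P_Suc)
        then obtain z where "z \<in> A n" "dist y z < \<rho> n / 2" using \<psi>0 by blast
        with False that show False using dist_triangle[of x z y] by fastforce
      qed
      moreover have "0 < \<rho> n / 2" using \<rho>[of n] by simp
      ultimately show ?thesis by blast
    qed
  qed
qed

text \<open>\<open>Q x\<close> is the set of derivatives allowed at \<open>x\<close>; it must be
  convex because the main part of the glued derivative is a convex combination of local ones. The
  radius is quantified before \<open>\<delta>\<close>, since the balls determine the partition, its
  derivative bounds \<open>B n\<close> determine the tolerances, and only then are the local
  functions chosen.\<close>

lemma C1_gluing:
  fixes F :: "'a::real_normed_vector \<Rightarrow> real"
  assumes C: "C1_approximable TYPE('a) C" and Q: "\<And>x. convex (Q x)" and \<epsilon>: "0 < \<epsilon>"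
    and loc: "\<And>s. \<exists>r>0. \<forall>\<delta>>0. \<exists>h h'. C1_deriv h h' \<and>
      (\<forall>x\<in>S \<inter> ball s r. \<bar>h x - F x\<bar> \<le> \<delta> \<and> h' x \<in> Q x)"
  obtains G G' where "C1_deriv G G'" "\<And>x. x \<in> S \<Longrightarrow> \<bar>G x - F x\<bar> \<le> \<epsilon>"
    "\<And>x. x \<in> S \<Longrightarrow> \<exists>q\<in>Q x. norm (G' x - q) \<le> \<epsilon>"
proof -
  obtain r where r: "\<And>s. 0 < r s" and loc': "\<And>s \<delta>. 0 < \<delta> \<Longrightarrow> \<exists>h h'. C1_deriv h h' \<and>
      (\<forall>x\<in>S \<inter> ball s (r s). \<bar>h x - F x\<bar> \<le> \<delta> \<and> h' x \<in> Q x)"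
    using loc by metis
  obtain \<phi> :: "nat \<Rightarrow> 'a \<Rightarrow> real" and \<phi>' B and b :: "nat \<Rightarrow> 'a \<Rightarrow> 'a" where
    \<phi>: "\<And>n. C1_deriv (\<phi> n) (\<phi>' n)" and \<phi>_nonneg: "\<And>n x. 0 \<le> \<phi> n x" and B: "\<And>n x. norm (\<phi>' n x) \<le> B n"
    and fin: "\<And>x. \<exists>d>0. \<exists>N. \<forall>y\<in>ball x d. (\<Sum>n<N. \<phi> n y) = 1 \<and> (\<forall>n\<ge>N. \<phi> n y = 0)"
    and b: "\<And>n x. \<exists>d>0. (\<forall>y\<in>ball x d. \<phi> n y = 0) \<or>
       (\<forall>y\<in>ball x d. b n y = b n x \<and> y \<in> ball (b n x) (r (b n x)))"
    by (rule C1_partition_of_unity[OF C r]) (rule that)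
  have B0: "0 \<le> B n" for n using B[of n 0] norm_ge_zero order_trans by blast
  \<comment> \<open>The denominator \<open>1 + B n\<close> serves two estimates:
    \<open>B n * \<delta> n \<le> \<epsilon> * (1/2)^Suc n\<close> for derivatives and
    \<open>\<delta> n \<le> \<epsilon>\<close> for values.\<close>
  define \<delta> where "\<delta> n = \<epsilon> * (1/2)^Suc n / (1 + B n)" for n
  have \<delta>: "0 < \<delta> n" for n using \<epsilon> B0[of n] by (simp add: \<delta>_def)
  have B\<delta>: "B n * \<delta> n \<le> \<epsilon> * (1/2)^Suc n" for n
    using \<epsilon> B0[of n] by (simp add: \<delta>_def divide_simps mult_mono)
  have \<delta>\<epsilon>: "\<delta> n \<le> \<epsilon>" for n
  proof -
    have "\<epsilon> * (1/2)^Suc n \<le> \<epsilon> * (1 + B n)"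
      using \<epsilon> B0[of n] power_le_one[of "1/2::real" "Suc n"] by (intro mult_left_mono) linarith+
    then show ?thesis unfolding \<delta>_def using B0[of n] by (subst pos_divide_le_eq) auto
  qed
  have "\<forall>n s. \<exists>h h'. C1_deriv h h' \<and>
      (\<forall>x\<in>S \<inter> ball s (r s). \<bar>h x - F x\<bar> \<le> \<delta> n \<and> h' x \<in> Q x)" using loc' \<delta> by blast
  then obtain h h' where hh: "\<And>n s. C1_deriv (h n s) (h' n s) \<and>
      (\<forall>x\<in>S \<inter> ball s (r s). \<bar>h n s x - F x\<bar> \<le> \<delta> n \<and> h' n s x \<in> Q x)"
    by metis
  then have h: "\<And>n s. C1_deriv (h n s) (h' n s)"
    and hF: "\<And>n s x. x \<in> S \<Longrightarrow> x \<in> ball s (r s) \<Longrightarrow> \<bar>h n s x - F x\<bar> \<le> \<delta> n"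
    and hQ: "\<And>n s x. x \<in> S \<Longrightarrow> x \<in> ball s (r s) \<Longrightarrow> h' n s x \<in> Q x"
    by blast+
  define g where "g n x = \<phi> n x * h n (b n x) x" for n x
  define g' where "g' n x = \<phi> n x *\<^sub>R h' n (b n x) x + h n (b n x) x *\<^sub>R \<phi>' n x" for n x
  have \<phi>'0: "\<phi>' n y = 0" if "\<forall>y\<in>ball x d. \<phi> n y = 0" "y \<in> ball x d" for n x y d
    using C1_deriv_cong_open[OF \<phi>[of n] C1_deriv_const[of 0], of "ball x d" y] that by simp
  have g: "C1_deriv (g n) (g' n)" for n
  proof (rule C1_deriv_local)
    fix x
    obtain d where d: "0 < d" and "(\<forall>y\<in>ball x d. \<phi> n y = 0) \<or> (\<forall>y\<in>ball x d. b n y = b n x)"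
      using b[of x n] by blast
    then consider "\<forall>y\<in>ball x d. \<phi> n y = 0" | "\<forall>y\<in>ball x d. b n y = b n x" by blast
    then show "\<exists>d>0. \<exists>k k'. C1_deriv k k' \<and> (\<forall>y\<in>ball x d. g n y = k y \<and> g' n y = k' y)"
    proof cases
      case 1
      with \<phi>'0[OF 1] have "\<forall>y\<in>ball x d. g n y = 0 \<and> g' n y = 0" by (simp add: g_def g'_def)
      with d show ?thesis using C1_deriv_const[of 0] by blast
    next
      case 2
      then have "\<forall>y\<in>ball x d. g n y = \<phi> n y * h n (b n x) y \<and>
          g' n y = \<phi> n y *\<^sub>R h' n (b n x) y + h n (b n x) y *\<^sub>R \<phi>' n y"
        by (simp add: g_def g'_def)
      with d show ?thesis using C1_deriv_mult[OF \<phi>[of n] h[of n "b n x"]] by blast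
    qed
  qed
  define G where "G x = (\<Sum>n. g n x)" for x
  define G' where "G' x = (\<Sum>n. g' n x)" for x
  have local_sum: "\<exists>d>0. \<exists>N. \<forall>y\<in>ball x d. G y = (\<Sum>n<N. g n y) \<and> G' y = (\<Sum>n<N. g' n y) \<and>
      (\<Sum>n<N. \<phi> n y) = 1 \<and> (\<Sum>n<N. \<phi>' n y) = 0" for x
  proof -
    obtain d N where d: "0 < d" and sum1: "\<And>y. y \<in> ball x d \<Longrightarrow> (\<Sum>n<N. \<phi> n y) = 1"
      and zero: "\<And>y n. y \<in> ball x d \<Longrightarrow> N \<le> n \<Longrightarrow> \<phi> n y = 0"
      using fin[of x] by blast
    have zero': "\<phi>' n y = 0" if "y \<in> ball x d" "N \<le> n" for y n
      using \<phi>'0[of x d n y] that zero by blast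
    have "g n y = 0" "g' n y = 0" if "y \<in> ball x d" "N \<le> n" for y n
      using zero[OF that] zero'[OF that] by (simp_all add: g_def g'_def)
    then have "G y = (\<Sum>n<N. g n y)" "G' y = (\<Sum>n<N. g' n y)" if "y \<in> ball x d" for y
      unfolding G_def G'_def using that by (intro suminf_finite; simp)+
    moreover have "(\<Sum>n<N. \<phi>' n y) = 0" if "y \<in> ball x d" for y
      using C1_deriv_cong_open[OF C1_deriv_sum[of N \<phi> \<phi>'] C1_deriv_const[of 1], of "ball x d" y] \<phi> that sum1
      by simp
    ultimately show ?thesis using d sum1 by blast
  qed
  \<comment> \<open>If the other alternative in \<open>b\<close> holds, \<open>\<phi> n\<close>
    vanishes on a ball around \<open>x\<close>, and so does its derivative.\<close>
  have active: "x \<in> ball (b n x) (r (b n x))" if "\<phi> n x \<noteq> 0 \<or> \<phi>' n x \<noteq> 0" for n x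
  proof -
    obtain d where "0 < d" and "(\<forall>y\<in>ball x d. \<phi> n y = 0) \<or> (\<forall>y\<in>ball x d. y \<in> ball (b n x) (r (b n x)))"
      using b[of x n] by blast
    then show ?thesis using \<phi>'0[of x d n x] that by auto
  qed
  show ?thesis
  proof
    show "C1_deriv G G'"
    proof (rule C1_deriv_local)
      fix x
      obtain d N where "0 < d" "\<forall>y\<in>ball x d. G y = (\<Sum>n<N. g n y) \<and> G' y = (\<Sum>n<N. g' n y)"
        using local_sum[of x] by blast
      then show "\<exists>d>0. \<exists>k k'. C1_deriv k k' \<and> (\<forall>y\<in>ball x d. G y = k y \<and> G' y = k' y)"
        using C1_deriv_sum[of N g g'] g by blast
    qed
  next
    fix x assume x: "x \<in> S"
    obtain N where Gx: "G x = (\<Sum>n<N. g n x)" "G' x = (\<Sum>n<N. g' n x)"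
      and sum1: "(\<Sum>n<N. \<phi> n x) = 1" and sum0: "(\<Sum>n<N. \<phi>' n x) = 0"
      using local_sum[of x] by (metis centre_in_ball)
    have near: "\<bar>h n (b n x) x - F x\<bar> \<le> \<delta> n" if "\<phi> n x \<noteq> 0 \<or> \<phi>' n x \<noteq> 0" for n
      using hF[OF x active[OF that]] .
    have "G x - F x = (\<Sum>n<N. \<phi> n x * (h n (b n x) x - F x))"
      by (simp add: Gx g_def right_diff_distrib sum_subtractf sum_distrib_right[symmetric] sum1)
    also have "\<bar>\<dots>\<bar> \<le> (\<Sum>n<N. \<phi> n x * \<epsilon>)"
    proof (rule order_trans[OF sum_abs sum_mono])
      fix n
      show "\<bar>\<phi> n x * (h n (b n x) x - F x)\<bar> \<le> \<phi> n x * \<epsilon>"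
        using near[of n] \<delta>\<epsilon>[of n] \<phi>_nonneg[of n x]
        by (cases "\<phi> n x = 0") (auto simp: abs_mult intro!: mult_left_mono)
    qed
    also have "\<dots> = \<epsilon>" by (simp add: sum_distrib_right[symmetric] sum1)
    finally show "\<bar>G x - F x\<bar> \<le> \<epsilon>" .
    \<comment> \<open>Membership of \<open>h' n (b n x) x\<close> in \<open>Q x\<close> is known
      only for active indices, so the convex combination is taken over these alone.\<close>
    define J where "J = {n \<in> {..<N}. \<phi> n x \<noteq> 0}"
    have J: "(\<Sum>n\<in>J. \<phi> n x) = 1"
      unfolding sum1[symmetric] J_def by (rule sum.mono_neutral_left) auto
    define q where "q = (\<Sum>n\<in>J. \<phi> n x *\<^sub>R h' n (b n x) x)"
    have q: "q = (\<Sum>n<N. \<phi> n x *\<^sub>R h' n (b n x) x)"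
      unfolding q_def J_def by (rule sum.mono_neutral_left) auto
    have "q \<in> Q x" unfolding q_def
      by (rule convex_sum[OF _ Q J \<phi>_nonneg]) (auto simp: J_def intro!: hQ[OF x active])
    moreover have "norm (G' x - q) \<le> \<epsilon>"
    proof -
      have "G' x - q = (\<Sum>n<N. h n (b n x) x *\<^sub>R \<phi>' n x)"
        by (simp add: Gx g'_def q sum.distrib)
      \<comment> \<open>Since the derivatives of the partition add up to 0 at \<open>x\<close>, the
        number \<open>F x\<close> may be subtracted from every coefficient; differentiability of
        \<open>F\<close> is not involved.\<close>
      also have "\<dots> = (\<Sum>n<N. (h n (b n x) x - F x) *\<^sub>R \<phi>' n x)"
        by (simp add: scaleR_left_diff_distrib sum_subtractf scaleR_sum_right[symmetric] sum0)
      also have "norm \<dots> \<le> (\<Sum>n<N. \<epsilon> * (1/2)^Suc n)"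
      proof (rule order_trans[OF norm_sum sum_mono])
        fix n
        show "norm ((h n (b n x) x - F x) *\<^sub>R \<phi>' n x) \<le> \<epsilon> * (1/2)^Suc n"
        proof (cases "\<phi>' n x = 0")
          case False
          have "norm ((h n (b n x) x - F x) *\<^sub>R \<phi>' n x) \<le> \<delta> n * B n"
            unfolding norm_scaleR using near[of n] False B[of n x] \<delta>[of n] by (intro mult_mono) auto
          with B\<delta>[of n] show ?thesis by (simp add: mult.commute)
        qed (use \<epsilon> in simp)
      qed
      also have "\<dots> = \<epsilon> * (\<Sum>n<N. (1/2)^Suc n)" by (simp add: sum_distrib_left)
      also have "(\<Sum>n<N. (1/2::real)^Suc n) \<le> 1"
        using sum_le_suminf[of "\<lambda>n. (1/2::real)^Suc n" "{..<N}"] power_half_series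
        by (simp add: sums_iff)
      finally show ?thesis using \<epsilon> by simp
    qed
    ultimately show "\<exists>q\<in>Q x. norm (G' x - q) \<le> \<epsilon>" by blast
  qed
qed

section \<open>Approximation of functions on a subspace\<close>

text \<open>Only the values of \<open>f' x\<close> on \<open>Y\<close> are determined by
  \<open>f\<close>; for this reason all estimates below test derivatives on vectors of
  \<open>Y\<close> instead of using the operator norm on \<open>X\<close>.\<close>

definition C1_deriv_on :: "'a::real_normed_vector set \<Rightarrow> ('a \<Rightarrow> real) \<Rightarrow> ('a \<Rightarrow> ('a \<Rightarrow>\<^sub>L real)) \<Rightarrow> bool" where
  "C1_deriv_on Y f f' \<longleftrightarrow>
      (\<forall>x\<in>Y. (f has_derivative blinfun_apply (f' x)) (at x within Y)) \<and>
      (\<forall>x\<in>Y. \<forall>e>0. \<exists>d>0. \<forall>y\<in>Y. dist y x < d \<longrightarrow>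
          (\<forall>v\<in>Y. \<bar>f' y v - f' x v\<bar> \<le> e * norm v))"

lemma C1_deriv_on_diff:
  assumes f: "C1_deriv_on Y f f'" and g: "C1_deriv g g'"
  shows "C1_deriv_on Y (\<lambda>x. f x - g x) (\<lambda>x. f' x - g' x)"
  unfolding C1_deriv_on_def
proof (intro conjI ballI allI impI)
  fix x assume x: "x \<in> Y"
  have "(g has_derivative blinfun_apply (g' x)) (at x within Y)"
    using g by (auto simp: C1_deriv_def intro: has_derivative_at_withinI)
  moreover have "(f has_derivative blinfun_apply (f' x)) (at x within Y)"
    using f x by (simp add: C1_deriv_on_def)
  ultimately show "((\<lambda>x. f x - g x) has_derivative blinfun_apply (f' x - g' x)) (at x within Y)"
    unfolding minus_blinfun.rep_eq by (intro has_derivative_diff)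
  fix e :: real assume "0 < e"
  then have e: "0 < e / 2" by simp
  obtain d1 where d1: "0 < d1"
    "\<And>y v. y \<in> Y \<Longrightarrow> dist y x < d1 \<Longrightarrow> v \<in> Y \<Longrightarrow> \<bar>f' y v - f' x v\<bar> \<le> e / 2 * norm v"
    using f x e unfolding C1_deriv_on_def by meson
  obtain d2 where d2: "0 < d2" "\<And>y. dist y x < d2 \<Longrightarrow> dist (g' y) (g' x) < e / 2"
    using g e unfolding C1_deriv_def continuous_at_eps_delta by meson
  have "\<bar>(f' y - g' y) v - (f' x - g' x) v\<bar> \<le> e * norm v"
    if "y \<in> Y" "dist y x < min d1 d2" "v \<in> Y" for y v
  proof -
    have "\<bar>(g' y - g' x) v\<bar> \<le> norm (g' y - g' x) * norm v"
      using norm_blinfun[of "g' y - g' x" v] by simp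
    also have "\<dots> \<le> e / 2 * norm v"
      using d2(2)[of y] that by (intro mult_right_mono) (auto simp: dist_norm)
    finally show ?thesis
      using d1(2)[of y v] that unfolding blinfun.diff_left by (auto; linarith)
  qed
  then show "\<exists>d>0. \<forall>y\<in>Y. dist y x < d \<longrightarrow> (\<forall>v\<in>Y. \<bar>(f' y - g' y) v - (f' x - g' x) v\<bar> \<le> e * norm v)"
    using d1(1) d2(1) by (intro exI[of _ "min d1 d2"]) auto
qed

text \<open>The mean value theorem on a segment inside \<open>A\<close>: the derivative is applied
  only to multiples of \<open>y - x\<close>, which lie in \<open>Y\<close>.\<close>

lemma subspace_derivative_bound_imp_lipschitz:
  fixes f :: "'a::real_normed_vector \<Rightarrow> real"
  assumes Y: "subspace Y" and A: "convex A" "A \<subseteq> Y" and M: "0 \<le> M"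
    and der: "\<And>x. x \<in> A \<Longrightarrow> (f has_derivative blinfun_apply (f' x)) (at x within A)"
    and bound: "\<And>x v. x \<in> A \<Longrightarrow> v \<in> Y \<Longrightarrow> \<bar>f' x v\<bar> \<le> M * norm v"
  shows "M-lipschitz_on A f"
proof (rule lipschitz_onI[OF _ M])
  fix x y assume xy: "x \<in> A" "y \<in> A"
  define p where "p t = x + t *\<^sub>R (y - x)" for t :: real
  have yx: "y - x \<in> Y" using Y A xy by (auto intro: subspace_diff)
  have pA: "p t \<in> A" if "t \<in> {0..1}" for t
  proof -
    have "p t = (1 - t) *\<^sub>R x + t *\<^sub>R y" by (simp add: p_def algebra_simps)
    with A(1) xy that show ?thesis by (simp add: convex_alt)
  qed
  have dp: "((\<lambda>t. f (p t)) has_derivative (\<lambda>s. f' (p t) (s *\<^sub>R (y - x)))) (at t within {0..1})"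
    if t: "t \<in> {0..1}" for t
  proof -
    have "(p has_derivative (\<lambda>s. s *\<^sub>R (y - x))) (at t within {0..1})"
      unfolding p_def by (auto intro!: derivative_eq_intros)
    moreover have "(f has_derivative blinfun_apply (f' (p t))) (at (p t) within p ` {0..1})"
      using der[OF pA[OF t]] pA by (auto intro: has_derivative_subset)
    ultimately show ?thesis by (rule has_derivative_in_compose)
  qed
  have "onorm (\<lambda>s. f' (p t) (s *\<^sub>R (y - x))) \<le> M * norm (y - x)" if t: "t \<in> {0..1}" for t
  proof (rule onorm_bound)
    show "norm (f' (p t) (s *\<^sub>R (y - x))) \<le> M * norm (y - x) * norm s" for s
      using bound[OF pA[OF t] yx] mult_left_mono[OF bound[OF pA[OF t] yx], of "\<bar>s\<bar>"]
      by (simp add: blinfun.scaleR_right abs_mult mult_ac)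
  qed (use M in simp)
  then have "norm (f (p 1) - f (p 0)) \<le> M * norm (y - x) * norm (1 - 0 :: real)"
    by (intro differentiable_bound[where f = "\<lambda>t. f (p t)", OF _ dp]) auto
  then show "dist (f x) (f y) \<le> M * dist x y"
    by (simp add: p_def dist_norm norm_minus_commute)
qed

text \<open>\<open>T\<close> may be any functional that agrees with \<open>f' s\<close> on
  \<open>Y\<close>; the Lipschitz case takes one of controlled norm. The estimate
  \<open>norm (g' x - T) \<le> \<epsilon>\<close> holds on all of \<open>X\<close> and is what
  transfers this norm control to \<open>g\<close>.\<close>

lemma tangent_approximation:
  fixes f :: "'a::real_normed_vector \<Rightarrow> real"
  assumes C: "C1_approximable TYPE('a) C" "1 \<le> C" and Y: "subspace Y" and f: "C1_deriv_on Y f f'"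
    and s: "s \<in> Y" and T: "\<And>v. v \<in> Y \<Longrightarrow> blinfun_apply T v = f' s v" and \<epsilon>: "0 < \<epsilon>"
  shows "\<exists>r>0. \<forall>\<delta>>0. \<exists>g g'. C1_deriv g g' \<and> (\<forall>x. norm (g' x - T) \<le> \<epsilon>) \<and>
    (\<forall>x\<in>Y \<inter> ball s r. \<bar>g x - f x\<bar> \<le> \<delta> \<and> (\<forall>v\<in>Y. \<bar>g' x v - f' x v\<bar> \<le> \<epsilon> * norm v))"
proof -
  \<comment> \<open>The derivative of the smoothed difference costs \<open>C * e\<close> and the
    variation of \<open>f'\<close> near \<open>s\<close> costs \<open>e\<close>; together they are
    \<open>\<epsilon>\<close>.\<close>
  define e where "e = \<epsilon> / (1 + C)"
  have "C * e + e = (1 + C) * e" by (simp add: algebra_simps)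
  then have e: "0 < e" "C * e + e = \<epsilon>" using \<epsilon> C(2) by (simp_all add: e_def)
  obtain r where r: "0 < r"
    and near: "\<And>x v. x \<in> Y \<Longrightarrow> dist x s < r \<Longrightarrow> v \<in> Y \<Longrightarrow> \<bar>f' x v - f' s v\<bar> \<le> e * norm v"
    using f s e(1) unfolding C1_deriv_on_def by meson
  have near': "\<bar>f' x v - T v\<bar> \<le> e * norm v" if "x \<in> Y \<inter> ball s r" "v \<in> Y" for x v
    using near[of x v] that T by (simp add: dist_commute)
  have "e-lipschitz_on (Y \<inter> ball s r) (\<lambda>x. f x - T x)"
  proof (rule subspace_derivative_bound_imp_lipschitz[OF Y, where f' = "\<lambda>x. f' x - T"])
    show "convex (Y \<inter> ball s r)" by (intro convex_Int convex_ball subspace_imp_convex Y)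
    show "((\<lambda>x. f x - T x) has_derivative blinfun_apply (f' x - T)) (at x within Y \<inter> ball s r)"
      if "x \<in> Y \<inter> ball s r" for x
    proof -
      have "(f has_derivative blinfun_apply (f' x)) (at x within Y \<inter> ball s r)"
        using f that unfolding C1_deriv_on_def by (auto intro: has_derivative_subset)
      then show ?thesis unfolding minus_blinfun.rep_eq
        by (intro has_derivative_diff bounded_linear_imp_has_derivative blinfun.bounded_linear_right)
    qed
    show "\<bar>(f' x - T) v\<bar> \<le> e * norm v" if "x \<in> Y \<inter> ball s r" "v \<in> Y" for x v
      using near'[OF that] by (simp add: blinfun.diff_left)
  qed (use e in auto)
  then obtain E where E: "e-lipschitz_on UNIV E" "\<And>x. x \<in> Y \<inter> ball s r \<Longrightarrow> E x = f x - T x"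
    by (rule lipschitz_extension) (rule that)
  have "\<exists>g g'. C1_deriv g g' \<and> (\<forall>x. norm (g' x - T) \<le> \<epsilon>) \<and>
    (\<forall>x\<in>Y \<inter> ball s r. \<bar>g x - f x\<bar> \<le> \<delta> \<and> (\<forall>v\<in>Y. \<bar>g' x v - f' x v\<bar> \<le> \<epsilon> * norm v))"
    if \<delta>: "0 < \<delta>" for \<delta>
  proof -
    obtain K K' where K: "C1_deriv K K'" "\<And>x. norm (K' x) \<le> C * e" "\<And>x. \<bar>E x - K x\<bar> \<le> \<delta>"
      using C1_approximableE[OF C(1) E(1) \<delta>] by metis
    have "\<bar>K x + T x - f x\<bar> \<le> \<delta>" if "x \<in> Y \<inter> ball s r" for x
      using K(3)[of x] E(2)[OF that] by linarith
    moreover have "\<bar>(K' x + T) v - f' x v\<bar> \<le> \<epsilon> * norm v" if "x \<in> Y \<inter> ball s r" "v \<in> Y" for x v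
    proof -
      have "\<bar>K' x v\<bar> \<le> C * e * norm v"
        using order_trans[OF norm_blinfun mult_right_mono[OF K(2) norm_ge_zero], of x v] by simp
      then have "\<bar>(K' x + T) v - f' x v\<bar> \<le> C * e * norm v + e * norm v"
        using near'[OF that] unfolding blinfun.add_left by linarith
      also have "\<dots> = \<epsilon> * norm v" unfolding e(2)[symmetric] by (rule distrib_right[symmetric])
      finally show ?thesis .
    qed
    moreover have "norm (K' x + T - T) \<le> \<epsilon>" for x using K(2)[of x] e by simp
    ultimately show ?thesis using C1_deriv_add[OF K(1) C1_deriv_blinfun[of T]] by blast
  qed
  with r show ?thesis by blast
qed

lemma convex_close_functionals:
  "convex {T :: 'a::real_normed_vector \<Rightarrow>\<^sub>L real. \<forall>v\<in>Y. \<bar>T v - \<phi> v\<bar> \<le> c * norm v}"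
proof (rule convexI, safe)
  fix S T :: "'a \<Rightarrow>\<^sub>L real" and u w :: real and v
  assume ST: "\<forall>v\<in>Y. \<bar>S v - \<phi> v\<bar> \<le> c * norm v" "\<forall>v\<in>Y. \<bar>T v - \<phi> v\<bar> \<le> c * norm v"
    and uw: "0 \<le> u" "0 \<le> w" "u + w = 1" and v: "v \<in> Y"
  have "(u *\<^sub>R S + w *\<^sub>R T) v - \<phi> v = u * (S v - \<phi> v) + w * (T v - \<phi> v)"
    using uw(3) by (simp add: blinfun.add_left blinfun.scaleR_left algebra_simps flip: distrib_right)
  also have "\<bar>\<dots>\<bar> \<le> u * (c * norm v) + w * (c * norm v)"
    using uw ST v by (intro order_trans[OF abs_triangle_ineq] add_mono)
      (auto simp: abs_mult intro!: mult_left_mono)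
  also have "\<dots> = c * norm v" using uw(3) by (simp flip: distrib_right)
  finally show "\<bar>(u *\<^sub>R S + w *\<^sub>R T) v - \<phi> v\<bar> \<le> c * norm v" .
qed

lemma close_functionals_trans:
  fixes S T :: "'a::real_normed_vector \<Rightarrow>\<^sub>L real"
  assumes "norm (S - T) \<le> a" "\<bar>T v - t\<bar> \<le> b * norm v"
  shows "\<bar>S v - t\<bar> \<le> (a + b) * norm v"
proof -
  have "\<bar>(S - T) v\<bar> \<le> a * norm v"
    using order_trans[OF norm_blinfun mult_right_mono[OF assms(1) norm_ge_zero], of v] by simp
  with assms(2) show ?thesis unfolding blinfun.diff_left distrib_right by linarith
qed

text \<open>Gluing with \<open>S = Y\<close>, so nothing is demanded off \<open>Y\<close>: around a
  point outside the closed set \<open>Y\<close> a small ball misses \<open>Y\<close> and the zero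
  function serves. Half of \<open>\<epsilon>\<close> goes into \<open>Q\<close>, half into the
  gluing error.\<close>

lemma approximation_on_subspace:
  fixes f :: "'a::real_normed_vector \<Rightarrow> real"
  assumes C: "C1_approximable TYPE('a) C" "1 \<le> C" and Y: "subspace Y" "closed Y"
    and f: "C1_deriv_on Y f f'" and \<epsilon>: "0 < \<epsilon>"
  obtains G G' where "C1_deriv G G'" "\<And>x. x \<in> Y \<Longrightarrow> \<bar>f x - G x\<bar> \<le> \<epsilon>"
    "\<And>x v. x \<in> Y \<Longrightarrow> v \<in> Y \<Longrightarrow> \<bar>(f' x - G' x) v\<bar> \<le> \<epsilon> * norm v"
proof -
  define Q where "Q x = {T :: 'a \<Rightarrow>\<^sub>L real. \<forall>v\<in>Y. \<bar>T v - f' x v\<bar> \<le> \<epsilon> / 2 * norm v}" for x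
  have Q: "convex (Q x)" for x unfolding Q_def by (rule convex_close_functionals)
  have \<epsilon>2: "0 < \<epsilon> / 2" using \<epsilon> by simp
  have "\<exists>r>0. \<forall>\<delta>>0. \<exists>h h'. C1_deriv h h' \<and>
      (\<forall>x\<in>Y \<inter> ball s r. \<bar>h x - f x\<bar> \<le> \<delta> \<and> h' x \<in> Q x)" for s
  proof (cases "s \<in> Y")
    case True
    from tangent_approximation[OF C Y(1) f True refl \<epsilon>2] show ?thesis
      unfolding Q_def by (simp add: ball_conj_distrib) meson
  next
    case False
    then obtain r where "0 < r" "ball s r \<subseteq> - Y"
      using Y(2) open_contains_ball[of "- Y"] by (auto simp: open_Compl)
    then have "Y \<inter> ball s r = {}" by blast
    with \<open>0 < r\<close> show ?thesis using C1_deriv_const[of 0] by (intro exI[of _ r]) auto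
  qed
  then obtain G G' where G: "C1_deriv G G'" "\<And>x. x \<in> Y \<Longrightarrow> \<bar>G x - f x\<bar> \<le> \<epsilon> / 2"
    and GQ: "\<And>x. x \<in> Y \<Longrightarrow> \<exists>q\<in>Q x. norm (G' x - q) \<le> \<epsilon> / 2"
    by (rule C1_gluing[OF C(1) Q \<epsilon>2]) (rule that)
  show ?thesis
  proof (rule that[OF G(1)])
    show "\<bar>f x - G x\<bar> \<le> \<epsilon>" if "x \<in> Y" for x using G(2)[OF that] \<epsilon> by linarith
    show "\<bar>(f' x - G' x) v\<bar> \<le> \<epsilon> * norm v" if xv: "x \<in> Y" "v \<in> Y" for x v
    proof -
      obtain q where q: "norm (G' x - q) \<le> \<epsilon> / 2" "\<bar>q v - f' x v\<bar> \<le> \<epsilon> / 2 * norm v"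
        using GQ[OF xv(1)] xv(2) unfolding Q_def by blast
      from close_functionals_trans[OF q] show ?thesis by (simp add: blinfun.diff_left abs_minus_commute)
    qed
  qed
qed

section \<open>Approximation with a derivative bound on the whole space\<close>

lemma one_minus_cos_le: "\<bar>1 - cos u\<bar> \<le> \<bar>u :: real\<bar>"
proof -
  have "1 - cos u = 2 * (sin (u / 2))\<^sup>2" using cos_double_sin[of "u / 2"] by simp
  also have "(sin (u / 2))\<^sup>2 \<le> \<bar>sin (u / 2)\<bar>"
    using mult_left_mono[OF abs_sin_le_one[of "u / 2"], of "\<bar>sin (u / 2)\<bar>"]
    by (simp add: power2_eq_square flip: abs_mult)
  also have "\<bar>sin (u / 2)\<bar> \<le> \<bar>u / 2\<bar>" by (rule abs_sin_x_le_abs_x)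
  finally show ?thesis by simp
qed

text \<open>A Lipschitz function \<open>g\<close> may be far from \<open>K\<close> away from \<open>Y\<close>, so it cannot be glued directly
  without losing control of the Lipschitz constant.  The truncation \<open>K + w sin ((g - K) / w)\<close> stays
  within \<open>w\<close> of \<open>K\<close> everywhere, and where \<open>\<bar>g - K\<bar>\<close> is much smaller than \<open>w\<close> its derivative is almost
  that of \<open>g\<close>.\<close>

lemma truncated_approximation:
  fixes g K :: "'a::real_normed_vector \<Rightarrow> real"
  assumes g: "C1_deriv g g'" and K: "C1_deriv K K'" and w: "0 < w"
    and D: "\<And>x. norm (g' x - K' x) \<le> D"
  obtains h h' where "C1_deriv h h'" "\<And>x. \<bar>h x - K x\<bar> \<le> w" "\<And>x. norm (h' x) \<le> norm (K' x) + D"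
    "\<And>x. norm (h' x - g' x) \<le> \<bar>g x - K x\<bar> / w * D"
proof -
  define u where "u x = (g x - K x) / w" for x
  define h where "h x = K x + w * sin (u x)" for x
  define h' where "h' x = K' x + cos (u x) *\<^sub>R (g' x - K' x)" for x
  have "C1_deriv (\<lambda>x. w * sin ((g x - K x) / w)) (\<lambda>x. cos ((g x - K x) / w) *\<^sub>R (g' x - K' x))"
    by (rule C1_deriv_compose[OF C1_deriv_diff[OF g K], of "\<lambda>t. w * sin (t / w)"])
      (use w in \<open>auto intro!: derivative_eq_intros continuous_intros\<close>)
  from C1_deriv_add[OF K this] have "C1_deriv h h'" unfolding h_def h'_def u_def .
  moreover have "\<bar>h x - K x\<bar> \<le> w" for x
    using mult_left_mono[OF abs_sin_le_one[of "u x"], of w] w by (simp add: h_def abs_mult)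
  moreover have "norm (h' x) \<le> norm (K' x) + D" for x
  proof -
    have "norm (cos (u x) *\<^sub>R (g' x - K' x)) \<le> 1 * D"
      unfolding norm_scaleR using D by (intro mult_mono) auto
    then show ?thesis unfolding h'_def by (intro norm_triangle_le) simp
  qed
  moreover have "norm (h' x - g' x) \<le> \<bar>g x - K x\<bar> / w * D" for x
  proof -
    have "h' x - g' x = - ((1 - cos (u x)) *\<^sub>R (g' x - K' x))"
      by (simp add: h'_def algebra_simps)
    also have "norm \<dots> \<le> \<bar>u x\<bar> * D"
      unfolding norm_minus_cancel norm_scaleR using D one_minus_cos_le by (intro mult_mono) auto
    also have "\<bar>u x\<bar> = \<bar>g x - K x\<bar> / w" using w by (simp add: u_def)
    finally show ?thesis .
  qed
  ultimately show ?thesis by (rule that)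
qed

text \<open>Gluing with \<open>S = UNIV\<close> against a global Lipschitz extension
  \<open>F\<close> of \<open>f\<close>. The set \<open>Q x\<close> bounds the norm at every
  \<open>x\<close>, and asks for closeness to \<open>f' x\<close> only when
  \<open>x \<in> Y\<close>. Around a point off \<open>Y\<close> a smoothing of \<open>F\<close>
  suffices; around a point of \<open>Y\<close> the tangent approximation is truncated towards such a
  smoothing.\<close>

lemma lipschitz_approximation_on_subspace:
  fixes f :: "'a::real_normed_vector \<Rightarrow> real"
  assumes C: "C1_approximable TYPE('a) C" "1 \<le> C" and Y: "subspace Y" "closed Y"
    and f: "C1_deriv_on Y f f'" and lip: "L-lipschitz_on Y f" and L: "0 < L" and \<epsilon>: "0 < \<epsilon>"
  obtains G G' where "C1_deriv G G'" "\<And>x. norm (G' x) \<le> (2 * C + 3) * L"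
    "\<And>x. x \<in> Y \<Longrightarrow> \<bar>f x - G x\<bar> \<le> \<epsilon>"
    "\<And>x v. x \<in> Y \<Longrightarrow> v \<in> Y \<Longrightarrow> \<bar>(f' x - G' x) v\<bar> \<le> \<epsilon> * norm v"
proof -
  obtain F where F: "L-lipschitz_on UNIV F" "\<And>x. x \<in> Y \<Longrightarrow> F x = f x"
    using lipschitz_extension[OF lip] by metis
  define Q where "Q x = {T :: 'a \<Rightarrow>\<^sub>L real. norm T \<le> (2 * C + 2) * L \<and>
    (x \<in> Y \<longrightarrow> (\<forall>v\<in>Y. \<bar>blinfun_apply T v - f' x v\<bar> \<le> \<epsilon> / 2 * norm v))}" for x
  have Q: "convex (Q x)" for x
  proof -
    have "Q x = cball 0 ((2 * C + 2) * L) \<inter>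
        (if x \<in> Y then {T :: 'a \<Rightarrow>\<^sub>L real. \<forall>v\<in>Y. \<bar>T v - f' x v\<bar> \<le> \<epsilon> / 2 * norm v} else UNIV)"
      by (auto simp: Q_def dist_norm)
    then show ?thesis
      by (cases "x \<in> Y")
        (simp_all only: if_True if_False convex_Int convex_cball convex_UNIV convex_close_functionals)
  qed
  have loc: "\<exists>r>0. \<forall>\<delta>>0. \<exists>h h'. C1_deriv h h' \<and>
      (\<forall>x\<in>UNIV \<inter> ball s r. \<bar>h x - F x\<bar> \<le> \<delta> \<and> h' x \<in> Q x)" for s
  proof (cases "s \<in> Y")
    case False
    then obtain r where r: "0 < r" "ball s r \<subseteq> - Y"
      using Y(2) open_contains_ball[of "- Y"] by (auto simp: open_Compl)
    have "\<exists>h h'. C1_deriv h h' \<and> (\<forall>x\<in>UNIV \<inter> ball s r. \<bar>h x - F x\<bar> \<le> \<delta> \<and> h' x \<in> Q x)"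
      if "0 < \<delta>" for \<delta>
    proof -
      obtain K K' where K: "C1_deriv K K'" "\<And>x. norm (K' x) \<le> C * L" "\<And>x. \<bar>F x - K x\<bar> \<le> \<delta>"
        using C1_approximableE[OF C(1) F(1) \<open>0 < \<delta>\<close>] by metis
      have "C * L \<le> (2 * C + 2) * L" using C(2) L by (intro mult_right_mono) auto
      then have "K' x \<in> Q x" if "x \<in> ball s r" for x
        using K(2)[of x] r that unfolding Q_def by auto
      with K show ?thesis by (metis IntD2 abs_minus_commute)
    qed
    with r(1) show ?thesis by blast
  next
    case True
    have "\<bar>f' s v\<bar> \<le> L * norm v" if "v \<in> Y" for v
      by (rule derivative_le_lipschitz[OF _ lip Y(1) True that])
        (use f True in \<open>simp add: C1_deriv_on_def\<close>)
    then obtain T :: "'a \<Rightarrow>\<^sub>L real" where T: "\<And>v. v \<in> Y \<Longrightarrow> T v = f' s v" "norm T \<le> L"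
      using functional_extension[OF Y(1), of "f' s" L] L by (metis less_imp_le)
    have e: "0 < min (\<epsilon> / 4) L" using \<epsilon> L by simp
    obtain r where r: "0 < r" and tangent: "\<forall>\<delta>>0. \<exists>g g'. C1_deriv g g' \<and> (\<forall>x. norm (g' x - T) \<le> min (\<epsilon> / 4) L) \<and>
       (\<forall>x\<in>Y \<inter> ball s r. \<bar>g x - f x\<bar> \<le> \<delta> \<and> (\<forall>v\<in>Y. \<bar>g' x v - f' x v\<bar> \<le> min (\<epsilon> / 4) L * norm v))"
      by (rule exE[OF tangent_approximation[OF C Y(1) f True T(1) e]]) (assumption, elim conjE, rule that)
    have "\<exists>h h'. C1_deriv h h' \<and> (\<forall>x\<in>UNIV \<inter> ball s r. \<bar>h x - F x\<bar> \<le> \<delta> \<and> h' x \<in> Q x)"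
      if "0 < \<delta>" for \<delta>
    proof -
      define w where "w = \<delta> / 2"
      have w: "0 < w" using \<open>0 < \<delta>\<close> by (simp add: w_def)
      define D where "D = (C + 2) * L"
      have D: "0 < D" using C(2) L by (simp add: D_def)
      \<comment> \<open>\<open>d \<le> w\<close> keeps \<open>h\<close> within
        \<open>2 w = \<delta>\<close> of \<open>F\<close>. On \<open>Y\<close> near \<open>s\<close>
        one has \<open>\<bar>g x - K x\<bar> \<le> 2 * d\<close>, so the second bound limits the
        change of derivative by truncation to \<open>\<epsilon> / 4\<close>.\<close>
      define d where "d = min w (w * \<epsilon> / (8 * D))"
      have d: "0 < d" "d \<le> w" using w D \<epsilon> by (simp_all add: d_def)
      have "d \<le> w * \<epsilon> / (8 * D)" by (simp add: d_def)
      then have dD: "2 * d / w * D \<le> \<epsilon> / 4" using w D by (simp add: field_simps)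
      obtain K K' where K: "C1_deriv K K'" "\<And>x. norm (K' x) \<le> C * L" "\<And>x. \<bar>F x - K x\<bar> \<le> d"
        using C1_approximableE[OF C(1) F(1) d(1)] by metis
      obtain g g' where g: "C1_deriv g g'" "\<And>x. norm (g' x - T) \<le> min (\<epsilon> / 4) L"
        and gf: "\<And>x. x \<in> Y \<inter> ball s r \<Longrightarrow> \<bar>g x - f x\<bar> \<le> d"
        and gf': "\<And>x v. x \<in> Y \<inter> ball s r \<Longrightarrow> v \<in> Y \<Longrightarrow> \<bar>g' x v - f' x v\<bar> \<le> min (\<epsilon> / 4) L * norm v"
        using tangent d(1) by blast
      have "norm (g' x - K' x) \<le> D" for x
      proof -
        have "g' x - K' x = (g' x - T) + T - K' x" by simp
        also have "norm \<dots> \<le> norm (g' x - T) + norm T + norm (K' x)"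
          by (meson add_mono norm_triangle_ineq norm_triangle_ineq4 order_refl order_trans)
        also have "\<dots> \<le> L + L + C * L" using g(2)[of x] T(2) K(2)[of x] by (intro add_mono) auto
        finally show ?thesis by (simp add: D_def algebra_simps)
      qed
      then obtain h h' where h: "C1_deriv h h'" "\<And>x. \<bar>h x - K x\<bar> \<le> w"
        "\<And>x. norm (h' x) \<le> norm (K' x) + D" "\<And>x. norm (h' x - g' x) \<le> \<bar>g x - K x\<bar> / w * D"
        by (rule truncated_approximation[OF g(1) K(1) w]) (rule that)
      have "\<bar>h x - F x\<bar> \<le> \<delta>" for x
        using h(2)[of x] K(3)[of x] d(2) unfolding w_def by linarith
      moreover have "h' x \<in> Q x" if x: "x \<in> ball s r" for x
      proof -
        have "norm (h' x) \<le> C * L + D" using h(3)[of x] K(2)[of x] by linarith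
        then have "norm (h' x) \<le> (2 * C + 2) * L" by (simp add: D_def algebra_simps)
        moreover have "\<bar>h' x v - f' x v\<bar> \<le> \<epsilon> / 2 * norm v" if "x \<in> Y" "v \<in> Y" for v
        proof -
          have xY: "x \<in> Y \<inter> ball s r" using x that by simp
          have "\<bar>g x - K x\<bar> \<le> 2 * d" using gf[OF xY] K(3)[of x] F(2)[OF that(1)] by linarith
          then have "\<bar>g x - K x\<bar> / w * D \<le> 2 * d / w * D"
            using w D by (intro mult_right_mono divide_right_mono) auto
          with h(4)[of x] dD have "norm (h' x - g' x) \<le> \<epsilon> / 4" by linarith
          moreover have "\<bar>g' x v - f' x v\<bar> \<le> \<epsilon> / 4 * norm v"
            using gf'[OF xY that(2)] mult_right_mono[OF min.cobounded1[of "\<epsilon> / 4" L], of "norm v"] by simp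
          ultimately have "\<bar>h' x v - f' x v\<bar> \<le> (\<epsilon> / 4 + \<epsilon> / 4) * norm v"
            by (rule close_functionals_trans)
          then show ?thesis by simp
        qed
        ultimately show ?thesis by (simp add: Q_def)
      qed
      ultimately show ?thesis using h(1) by blast
    qed
    with r show ?thesis by blast
  qed
  have e': "0 < min (\<epsilon> / 2) L" using \<epsilon> L by simp
  obtain G G' where G: "C1_deriv G G'" "\<And>x. x \<in> UNIV \<Longrightarrow> \<bar>G x - F x\<bar> \<le> min (\<epsilon> / 2) L"
    and GQ: "\<And>x. x \<in> UNIV \<Longrightarrow> \<exists>q\<in>Q x. norm (G' x - q) \<le> min (\<epsilon> / 2) L"
    by (rule C1_gluing[OF C(1) Q e' loc]) (rule that)
  show ?thesis
  proof (rule that[OF G(1)])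
    show "norm (G' x) \<le> (2 * C + 3) * L" for x
    proof -
      obtain q where "norm (G' x - q) \<le> L" "norm q \<le> (2 * C + 2) * L"
        using GQ[OF UNIV_I, of x] unfolding Q_def by auto
      then have "norm (G' x) \<le> L + (2 * C + 2) * L"
        using norm_triangle_sub[of "G' x" q] by linarith
      then show ?thesis by (simp add: algebra_simps)
    qed
    show "\<bar>f x - G x\<bar> \<le> \<epsilon>" if "x \<in> Y" for x
      using G(2)[OF UNIV_I, of x] F(2)[OF that] \<epsilon> by linarith
    show "\<bar>(f' x - G' x) v\<bar> \<le> \<epsilon> * norm v" if xv: "x \<in> Y" "v \<in> Y" for x v
    proof -
      obtain q where q: "norm (G' x - q) \<le> \<epsilon> / 2" "\<bar>q v - f' x v\<bar> \<le> \<epsilon> / 2 * norm v"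
        using GQ[OF UNIV_I, of x] xv unfolding Q_def by auto
      from close_functionals_trans[OF q] show ?thesis by (simp add: blinfun.diff_left abs_minus_commute)
    qed
  qed
qed

section \<open>Extension\<close>

text \<open>By the Weierstrass test the series of derivatives converges uniformly on the whole
  space; convergence of the functions at the single point \<open>x0\<close> then spreads to all
  points.\<close>

lemma C1_series:
  fixes g :: "nat \<Rightarrow> 'a::real_normed_vector \<Rightarrow> real"
  assumes g: "\<And>n. C1_deriv (g n) (g' n)" and bound: "\<And>n x. norm (g' n x) \<le> M n" and M: "M sums S"
    and conv: "(\<lambda>n. g n x0) sums l"
  obtains H H' where "C1_deriv H H'" "\<And>x. (\<lambda>n. g n x) sums H x" "\<And>x. norm (H' x) \<le> S"
proof -
  define H' where "H' x = (\<Sum>n. g' n x)" for x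
  have "summable M" using M by (simp add: sums_iff)
  have unif: "uniform_limit UNIV (\<lambda>n x. \<Sum>i<n. g' i x) H' sequentially"
    unfolding H'_def using bound \<open>summable M\<close> by (intro Weierstrass_m_test) auto
  have "\<exists>H. \<forall>x\<in>UNIV. (\<lambda>n. g n x) sums H x \<and> (H has_derivative blinfun_apply (H' x)) (at x within UNIV)"
  proof (rule has_derivative_series[where f = g and f' = "\<lambda>n x. blinfun_apply (g' n x)" and x = x0 and l = l])
    show "(g n has_derivative blinfun_apply (g' n x)) (at x within UNIV)" for n x
      using g by (simp add: C1_deriv_def)
    fix e :: real assume "0 < e"
    with unif have "\<forall>\<^sub>F n in sequentially. \<forall>x\<in>UNIV. dist (\<Sum>i<n. g' i x) (H' x) < e"
      by (simp add: uniform_limit_iff)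
    then show "\<forall>\<^sub>F n in sequentially. \<forall>x\<in>UNIV. \<forall>v. norm ((\<Sum>i<n. g' i x v) - H' x v) \<le> e * norm v"
    proof (eventually_elim, safe)
      fix n x v assume *: "\<forall>x\<in>UNIV. dist (\<Sum>i<n. g' i x) (H' x) < e"
      have "norm (((\<Sum>i<n. g' i x) - H' x) v) \<le> e * norm v"
        using * by (intro order_trans[OF norm_blinfun] mult_right_mono)
          (auto simp: dist_norm intro: less_imp_le)
      then show "norm ((\<Sum>i<n. g' i x v) - H' x v) \<le> e * norm v"
        by (simp add: blinfun.diff_left blinfun.sum_left)
    qed
  qed (use conv in auto)
  then obtain H where H: "\<And>x. (\<lambda>n. g n x) sums H x"
    "\<And>x. (H has_derivative blinfun_apply (H' x)) (at x)" by auto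
  have "continuous_on UNIV (\<lambda>x. \<Sum>i<n. g' i x)" for n
    using g by (intro continuous_on_sum) (auto simp: C1_deriv_def continuous_on_eq_continuous_at)
  then have "continuous_on UNIV H'"
    by (intro uniform_limit_theorem[OF _ unif]) auto
  with H(2) have "C1_deriv H H'" by (simp add: C1_deriv_def continuous_on_eq_continuous_at)
  moreover have "norm (H' x) \<le> S" for x
    unfolding H'_def using norm_suminf_le[of "\<lambda>n. g' n x" M] bound M by (simp add: sums_iff)
  ultimately show ?thesis using H(1) that by blast
qed

text \<open>Values and derivatives of the n-th remainder are bounded by \<open>\<eta> / 2^n\<close>
  on \<open>Y\<close>. The derivative bound makes it Lipschitz, so that the next approximant has
  derivative at most \<open>M \<eta> / 2^n\<close> on all of \<open>X\<close>; the value bound sends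
  the remainders to 0, so that the approximants add up to \<open>f\<close> on
  \<open>Y\<close>.\<close>

lemma extension_of_small:
  fixes f :: "'a::real_normed_vector \<Rightarrow> real"
  assumes C: "C1_approximable TYPE('a) C" "1 \<le> C" and Y: "subspace Y" "closed Y" and \<eta>: "0 < \<eta>"
    and f: "C1_deriv_on Y f f'" "\<And>x. x \<in> Y \<Longrightarrow> \<bar>f x\<bar> \<le> \<eta>"
      "\<And>x v. x \<in> Y \<Longrightarrow> v \<in> Y \<Longrightarrow> \<bar>f' x v\<bar> \<le> \<eta> * norm v"
  obtains H H' where "C1_deriv H H'" "\<And>x. x \<in> Y \<Longrightarrow> H x = f x"
    "\<And>x. norm (H' x) \<le> 2 * (2 * C + 3) * \<eta>"
proof -
  define M where "M = 2 * C + 3"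
  define P where "P n p \<longleftrightarrow> C1_deriv_on Y (fst p) (snd p) \<and> (\<forall>x\<in>Y. \<bar>fst p x\<bar> \<le> \<eta> * (1/2)^n \<and>
      (\<forall>v\<in>Y. \<bar>snd p x v\<bar> \<le> \<eta> * (1/2)^n * norm v))"
    for n and p :: "('a \<Rightarrow> real) \<times> ('a \<Rightarrow> 'a \<Rightarrow>\<^sub>L real)"
  define R where "R n p q \<longleftrightarrow> C1_deriv (\<lambda>x. fst p x - fst q x) (\<lambda>x. snd p x - snd q x) \<and>
      (\<forall>x. norm (snd p x - snd q x) \<le> M * (\<eta> * (1/2)^n))"
    for n and p q :: "('a \<Rightarrow> real) \<times> ('a \<Rightarrow> 'a \<Rightarrow>\<^sub>L real)"
  have "\<exists>q. P (Suc n) q \<and> R n p q" if p: "P n p" for n p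
  proof -
    have n: "0 < \<eta> * (1/2)^n" "0 < \<eta> * (1/2)^Suc n" using \<eta> by simp_all
    have lip: "(\<eta> * (1/2)^n)-lipschitz_on Y (fst p)"
      by (rule subspace_derivative_bound_imp_lipschitz[OF Y(1), where f' = "snd p"])
        (use p Y(1) \<eta> in \<open>auto simp: P_def C1_deriv_on_def subspace_imp_convex\<close>)
    obtain G G' where G: "C1_deriv G G'" "\<And>x. norm (G' x) \<le> (2 * C + 3) * (\<eta> * (1/2)^n)"
      "\<And>x. x \<in> Y \<Longrightarrow> \<bar>fst p x - G x\<bar> \<le> \<eta> * (1/2)^Suc n"
      "\<And>x v. x \<in> Y \<Longrightarrow> v \<in> Y \<Longrightarrow> \<bar>(snd p x - G' x) v\<bar> \<le> \<eta> * (1/2)^Suc n * norm v"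
      using p lipschitz_approximation_on_subspace[OF C Y _ lip n] unfolding P_def by blast
    have "P (Suc n) (\<lambda>x. fst p x - G x, \<lambda>x. snd p x - G' x)"
      using p G C1_deriv_on_diff[OF _ G(1)] by (auto simp: P_def)
    moreover have "R n p (\<lambda>x. fst p x - G x, \<lambda>x. snd p x - G' x)"
      using G by (simp add: R_def M_def)
    ultimately show ?thesis by blast
  qed
  \<comment> \<open>The clause for \<open>n = 0\<close> fixes the first pair as
    \<open>(f, f')\<close>, which dependent choice would otherwise leave open; at successors it is
    vacuous.\<close>
  then have step: "\<exists>q. (P (Suc n) q \<and> (Suc n = 0 \<longrightarrow> q = (f, f'))) \<and> R n p q"
    if "P n p \<and> (n = 0 \<longrightarrow> p = (f, f'))" for n p
    using that by auto
  have start: "\<exists>p. P 0 p \<and> (0 = (0::nat) \<longrightarrow> p = (f, f'))" using f by (simp add: P_def)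
  have "\<exists>p. \<forall>n. (P n (p n) \<and> (n = 0 \<longrightarrow> p n = (f, f'))) \<and> R n (p n) (p (Suc n))"
    by (rule dependent_nat_choice[of "\<lambda>n p. P n p \<and> (n = 0 \<longrightarrow> p = (f, f'))" R, OF start step])
  then obtain p where p: "\<forall>n. (P n (p n) \<and> (n = 0 \<longrightarrow> p n = (f, f'))) \<and> R n (p n) (p (Suc n))" ..
  have p0: "p 0 = (f, f')" by (rule mp[OF conjunct2[OF conjunct1[OF spec[OF p]]] refl])
  have pP: "P n (p n)" for n by (rule conjunct1[OF conjunct1[OF spec[OF p]]])
  have pR: "R n (p n) (p (Suc n))" for n by (rule conjunct2[OF spec[OF p]])
  have sums_f: "(\<lambda>n. fst (p n) x - fst (p (Suc n)) x) sums f x" if "x \<in> Y" for x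
  proof -
    have "(\<lambda>n. (1/2::real)^n) \<longlonglongrightarrow> 0" by (rule LIMSEQ_realpow_zero) auto
    then have lim: "(\<lambda>n. \<eta> * (1/2)^n) \<longlonglongrightarrow> 0" by (rule tendsto_mult_right_zero)
    have "\<forall>n. norm (fst (p n) x) \<le> \<eta> * (1/2)^n"
      using pP that unfolding P_def real_norm_def by blast
    then have "(\<lambda>n. fst (p n) x) \<longlonglongrightarrow> 0"
      by (rule Lim_null_comparison[OF always_eventually lim])
    from telescope_sums'[OF this] show ?thesis by (simp add: p0)
  qed
  have "(\<lambda>n. M * \<eta> * (1/2)^n) sums (M * \<eta> * (1 / (1 - 1/2)))"
    by (intro sums_mult geometric_sums) simp
  then have M_sums: "(\<lambda>n. M * (\<eta> * (1/2)^n)) sums (2 * M * \<eta>)" by (simp add: mult_ac)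
  have g: "C1_deriv (\<lambda>x. fst (p n) x - fst (p (Suc n)) x) (\<lambda>x. snd (p n) x - snd (p (Suc n)) x)"
    and g_bound: "norm (snd (p n) x - snd (p (Suc n)) x) \<le> M * (\<eta> * (1/2)^n)" for n x
    using pR[of n] by (simp_all add: R_def)
  obtain H H' where H: "C1_deriv H H'" "\<And>x. (\<lambda>n. fst (p n) x - fst (p (Suc n)) x) sums H x"
    "\<And>x. norm (H' x) \<le> 2 * M * \<eta>"
    by (rule C1_series[OF g g_bound M_sums sums_f[OF subspace_0[OF Y(1)]]]) (rule that)
  show ?thesis
    using H sums_unique2[OF H(2) sums_f] by (intro that[of H H']) (auto simp: M_def)
qed

theorem theorem1p2:
  assumes "property_star TYPE('a::banach)"
  shows "(\<forall>(Y::'a set) f. closed Y \<and> subspace Y \<and> C1_smooth_on Y f \<longrightarrow>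
            (\<exists>H. C1_smooth H \<and> (\<forall>y\<in>Y. H y = f y)))
       \<and> (\<exists>C\<ge>1. \<forall>(Y::'a set) f. closed Y \<and> subspace Y \<and> C1_smooth_on Y f \<and> lipschitz_fun Y f \<longrightarrow>
            (\<exists>H. C1_smooth H \<and> lipschitz_fun UNIV H \<and> (\<forall>y\<in>Y. H y = f y) \<and>
                 Lip UNIV H \<le> C * Lip Y f))"
proof -
  obtain C where C: "C1_approximable TYPE('a) C" "1 \<le> C"
    using property_star_imp_C1_approximable[OF assms] by metis
  have first: "\<exists>H. C1_smooth H \<and> (\<forall>y\<in>Y. H y = f y)"
    if Y: "closed Y" "subspace Y" and "C1_smooth_on Y f" for Y :: "'a set" and f
  proof -
    obtain f' where f: "C1_deriv_on Y f f'"
      using \<open>C1_smooth_on Y f\<close> unfolding C1_smooth_on_def C1_deriv_on_def by blast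
    \<comment> \<open>The tolerance 1 is arbitrary: subtracting \<open>G\<close> leaves a function
      whose values and derivative along \<open>Y\<close> are bounded, which \<open>f\<close> itself
      need not have.\<close>
    obtain G G' where G: "C1_deriv G G'" "\<And>x. x \<in> Y \<Longrightarrow> \<bar>f x - G x\<bar> \<le> 1"
      "\<And>x v. x \<in> Y \<Longrightarrow> v \<in> Y \<Longrightarrow> \<bar>(f' x - G' x) v\<bar> \<le> 1 * norm v"
      by (rule approximation_on_subspace[OF C Y(2,1) f zero_less_one]) (rule that)
    obtain H H' where H: "C1_deriv H H'" "\<And>x. x \<in> Y \<Longrightarrow> H x = f x - G x"
      using extension_of_small[OF C Y(2,1) zero_less_one C1_deriv_on_diff[OF f G(1)] G(2,3)] by metis
    have "C1_smooth (\<lambda>x. G x + H x)"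
      using C1_deriv_add[OF G(1) H(1)] by (auto simp: C1_smooth_iff)
    with H(2) show ?thesis by (intro exI[of _ "\<lambda>x. G x + H x"]) auto
  qed
  \<comment> \<open>The factor 3 is 1 for the first approximation \<open>G\<close> plus 2 for the
    geometric series extending \<open>f - G\<close>.\<close>
  have second: "\<exists>H. C1_smooth H \<and> lipschitz_fun UNIV H \<and> (\<forall>y\<in>Y. H y = f y) \<and>
      Lip UNIV H \<le> (3 * (2 * C + 3)) * Lip Y f"
    if Y: "closed Y" "subspace Y" and "C1_smooth_on Y f" and lf: "lipschitz_fun Y f"
    for Y :: "'a set" and f
  proof -
    define L where "L = Lip Y f"
    have lip: "L-lipschitz_on Y f" unfolding L_def by (rule lipschitz_on_Lip[OF lf])
    have "\<exists>H H'. C1_deriv H H' \<and> (\<forall>y\<in>Y. H y = f y) \<and> (\<forall>x. norm (H' x) \<le> 3 * (2 * C + 3) * L)"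
    proof (cases "L = 0")
      \<comment> \<open>The approximation lemma requires a positive constant; for
        \<open>L = 0\<close> the function is constant on \<open>Y\<close> and extends as a
        constant.\<close>
      case True
      have "f y = f 0" if "y \<in> Y" for y
        using lipschitz_onD[OF lip that subspace_0[OF Y(2)]] True by simp
      with True show ?thesis
        using C1_deriv_const[of "f 0"] by (intro exI[of _ "\<lambda>x. f 0"] exI[of _ "\<lambda>x. 0"]) auto
    next
      case False
      with lipschitz_on_nonneg[OF lip] have L: "0 < L" by simp
      obtain f' where f: "C1_deriv_on Y f f'"
        using \<open>C1_smooth_on Y f\<close> unfolding C1_smooth_on_def C1_deriv_on_def by blast
      obtain G G' where G: "C1_deriv G G'" "\<And>x. norm (G' x) \<le> (2 * C + 3) * L"
        "\<And>x. x \<in> Y \<Longrightarrow> \<bar>f x - G x\<bar> \<le> L"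
        "\<And>x v. x \<in> Y \<Longrightarrow> v \<in> Y \<Longrightarrow> \<bar>(f' x - G' x) v\<bar> \<le> L * norm v"
        by (rule lipschitz_approximation_on_subspace[OF C Y(2,1) f lip L L]) (rule that)
      obtain H H' where H: "C1_deriv H H'" "\<And>x. x \<in> Y \<Longrightarrow> H x = f x - G x"
        "\<And>x. norm (H' x) \<le> 2 * (2 * C + 3) * L"
        using extension_of_small[OF C Y(2,1) L C1_deriv_on_diff[OF f G(1)] G(3,4)] by metis
      have "norm (G' x + H' x) \<le> 3 * (2 * C + 3) * L" for x
        using norm_triangle_mono[OF G(2) H(3), of x x] by (simp add: algebra_simps)
      then show ?thesis
        using C1_deriv_add[OF G(1) H(1)] H(2)
        by (intro exI[of _ "\<lambda>x. G x + H x"] exI[of _ "\<lambda>x. G' x + H' x"]) auto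
    qed
    then obtain H H' where H: "C1_deriv H H'" "\<forall>y\<in>Y. H y = f y"
      "\<And>x. norm (H' x) \<le> 3 * (2 * C + 3) * L" by blast
    have "(3 * (2 * C + 3) * L)-lipschitz_on UNIV H"
      using C(2) lipschitz_on_nonneg[OF lip] by (intro C1_deriv_imp_lipschitz[OF H(1,3)]) simp
    then show ?thesis
      using H(1,2) Lip_le unfolding C1_smooth_iff lipschitz_fun_def L_def by blast
  qed
  have "1 \<le> 3 * (2 * C + 3)" using C(2) by simp
  with first second show ?thesis by blast
qed

end
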